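(* Let $U$ be the $\mathbb{C}$-algebra generated by $X,Y,Z$ subject to the relations $XZ+ZX=2X$, $YZ+ZY=-2Y$, $X^2-Y^2=Z$. Any finite-dimensional non-zero simple $U$-module is isomorphic to one of the modules $E_n$ ($n\ge0$), $A_n^+$, $A_n^-$ ($n\ge1$), $B_n^+$, $B_n^-$ ($n\ge0$).
   Context: The algebra $U$ arises as a twist $U_F(\mathfrak{sl}_2)$ of the enveloping algebra of $\mathfrak{sl}_2$. The modules (all over $\mathbb{C}$) are as follows. **$E_n$ ($n\ge0$)**: dimension $2n+1$, basis $v_k$ ($0\le k\le n$), $w_k$ ($0\le k<n$), with conventions $w_n=w_{-1}=0$: $Zv_k=(2n-4k)v_k$, $Zw_k=(4k+2-2n)w_k$; $Xv_k=w_k$, $Xw_k=(2n+k(4n-2-4k))v_k$; $Yv_k=k(4n+2-4k)w_{k-1}$, $Yw_k=v_{k+1}$. **$A_n^\pm$ ($n\ge1$)**: dimension $n$, basis $v_k$ ($0\le k<n$); put $w_k=v_{n-1-k}$ and use the convention $w_{-1}=0$. $Zv_k=(2n-1-4k)v_k$. Consider the formulas (X) $Xv_k=w_k$, $Xw_k=(2n-1+4k(n-k-1))v_k$; (Y) $Yw_j=v_{j+1}$, $Yv_k=4k(n-k)w_{k-1}$. If $n=2m$: $X$ is given by (X) for $0\le k\le m-1$; $Y$ is given by (Y) for $0\le k\le m-1$ and $0\le j\le m-2$, and $Yw_{m-1}=Yv_m=\pm n\,v_m$. If $n=2m+1$: $X$ is given by (X) for $0\le k\le m-1$ and $Xv_m=Xw_m=\pm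 n\,v_m$; $Y$ is given by (Y) for $0\le j\le m-1$ and $0\le k\le m$. **$B_0^\pm$**: one-dimensional with $X=0$, $Y=\pm1$, $Z=-1$. **$B_n^\pm$ ($n\ge1$)**: dimension $n+1$, basis $v_k$ ($0\le k<n$) and $u$; put $w_k=v_{n-1-k}$ for $0\le k<n$, and $w_{-1}=u$. $Zv_k=(2n-1-4k)v_k$, $Zu=(-2n-1)u$, $Xu=0$, $Yv_0=(2n+1)u$, $Yu=v_0$. Consider the formulas (X') $Xv_k=w_k$, $Xw_k=(4n+4k(n-k-1))v_k$; (Y') $Yw_j=v_{j+1}$, $Yv_k=(2n+1+4k(n-k))w_{k-1}$. If $n=2m$: $X$ is given by (X') for $0\le k\le m-1$; $Y$ is given by (Y') for $0\le k\le m-1$ and $0\le j\le m-2$, and $Yw_{m-1}=Yv_m=\pm(n+1)v_m$. If $n=2m+1$: $X$ is given by (X') for $0\le k\le m-1$ and $Xv_m=Xw_m=\pm(n+1)v_m$; $Y$ is given by (Y') for $0\le k\le m$ and $0\le j\le m-1$. *)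

theory Defs
  imports Complex_Main "HOL-Library.Poly_Mapping"
begin

section \<open>The algebra $U$\<close>

text \<open>
  The free algebra on $X, Y, Z$ is the monoid algebra of the free monoid of words; the monoid
  has to be written additively for the product of \<^theory>\<open>HOL-Library.Poly_Mapping\<close>.
\<close>

datatype gen = GX | GY | GZ

datatype gword = Word (letters: "gen list")

instantiation gword :: monoid_add
begin

definition zero_gword :: gword where "0 = Word []"
definition plus_gword :: "gword \<Rightarrow> gword \<Rightarrow> gword"
  where "v + w = Word (letters v @ letters w)"

instance
  by standard (simp_all add: zero_gword_def plus_gword_def)

end

type_synonym free_alg = "gword \<Rightarrow>\<^sub>0 complex"

definition free_gen :: "gen \<Rightarrow> free_alg" where
  "free_gen g = Poly_Mapping.single (Word [g]) 1"

definition relators :: "free_alg set" where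
  "relators =
    (let X = free_gen GX; Y = free_gen GY; Z = free_gen GZ
     in {X * Z + Z * X - 2 * X, Y * Z + Z * Y - (- 2 * Y), X\<^sup>2 - Y\<^sup>2 - Z})"

inductive_set two_sided_ideal :: "'a::ring_1 set \<Rightarrow> 'a set" for S where
  zero: "0 \<in> two_sided_ideal S"
| gen: "s \<in> S \<Longrightarrow> a * s * b \<in> two_sided_ideal S"
| add: "p \<in> two_sided_ideal S \<Longrightarrow> q \<in> two_sided_ideal S \<Longrightarrow> p + q \<in> two_sided_ideal S"

lemma two_sided_ideal_mult:
  assumes "p \<in> two_sided_ideal S"
  shows "c * p * d \<in> two_sided_ideal S"
  using assms
proof induction
  case zero
  then show ?case by (simp add: two_sided_ideal.zero)
next
  case (gen s a b)
  have "c * (a * s * b) * d = (c * a) * s * (b * d)"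
    by (simp add: mult.assoc)
  then show ?case
    using two_sided_ideal.gen[OF gen, of "c * a" "b * d"] by simp
next
  case (add p q)
  then show ?case
    by (simp add: distrib_left distrib_right two_sided_ideal.add)
qed

lemma two_sided_ideal_uminus: "p \<in> two_sided_ideal S \<Longrightarrow> - p \<in> two_sided_ideal S"
  using two_sided_ideal_mult[of p S "- 1" 1] by simp

lemma two_sided_ideal_base: "s \<in> S \<Longrightarrow> s \<in> two_sided_ideal S"
  using two_sided_ideal.gen[of s S 1 1] by simp

lemma lookup_mult_zero_gword:
  "Poly_Mapping.lookup (p * q :: free_alg) 0 =
    Poly_Mapping.lookup p 0 * Poly_Mapping.lookup q 0"
proof -
  have eq0: "0 = v + w \<longleftrightarrow> v = 0 \<and> w = 0" for v w :: gword
    by (cases v; cases w) (auto simp: zero_gword_def plus_gword_def)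
  have "(Poly_Mapping.lookup q w when 0 = v + w) =
      (Poly_Mapping.lookup q w when w = 0) * (1 when v = 0)" for v w :: gword
    by (auto simp: eq0 when_def)
  then have "Poly_Mapping.lookup (p * q) 0 =
      (\<Sum>v. Poly_Mapping.lookup p v * (\<Sum>w. (Poly_Mapping.lookup q w when w = 0) * (1 when v = 0)))"
    by (simp add: lookup_mult)
  also have "(\<lambda>v. \<Sum>w. (Poly_Mapping.lookup q w when w = 0) * (1 when v = (0 :: gword))) =
      (\<lambda>v. Poly_Mapping.lookup q 0 when v = 0)"
    by (rule ext) (auto simp: when_def)
  finally show ?thesis
    by (simp add: mult_when)
qed

lemma const_coeff_relators:
  "p \<in> two_sided_ideal relators \<Longrightarrow> Poly_Mapping.lookup p 0 = 0"
proof (induction rule: two_sided_ideal.induct)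
  case (gen s a b)
  have "Poly_Mapping.lookup (free_gen g) 0 = 0" for g
    by (simp add: free_gen_def lookup_single zero_gword_def when_def)
  then have "Poly_Mapping.lookup s 0 = 0"
    using gen by (auto simp: relators_def Let_def lookup_mult_zero_gword lookup_add lookup_minus
        power2_eq_square)
  then show ?case
    by (simp add: lookup_mult_zero_gword)
qed (simp_all add: lookup_add)

quotient_type U_alg = free_alg / "\<lambda>p q. p - q \<in> two_sided_ideal relators"
proof (rule equivpI)
  show "reflp (\<lambda>p q. p - q \<in> two_sided_ideal relators)"
    by (simp add: reflp_def two_sided_ideal.zero)
  show "symp (\<lambda>p q. p - q \<in> two_sided_ideal relators)"
    by (rule sympI) (use two_sided_ideal_uminus in fastforce)
  show "transp (\<lambda>p q. p - q \<in> two_sided_ideal relators)"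
  proof (rule transpI)
    fix p q r :: free_alg
    assume "p - q \<in> two_sided_ideal relators" "q - r \<in> two_sided_ideal relators"
    from two_sided_ideal.add[OF this] show "p - r \<in> two_sided_ideal relators"
      by simp
  qed
qed

instantiation U_alg :: ring_1
begin

lift_definition zero_U_alg :: U_alg is "0 :: free_alg" .
lift_definition one_U_alg :: U_alg is "1 :: free_alg" .

lift_definition plus_U_alg :: "U_alg \<Rightarrow> U_alg \<Rightarrow> U_alg" is "(+) :: free_alg \<Rightarrow> _"
proof -
  fix p p' q q' :: free_alg
  assume "p - p' \<in> two_sided_ideal relators" "q - q' \<in> two_sided_ideal relators"
  from two_sided_ideal.add[OF this] show "p + q - (p' + q') \<in> two_sided_ideal relators"
    by (simp add: algebra_simps)
qed

lift_definition uminus_U_alg :: "U_alg \<Rightarrow> U_alg" is "uminus :: free_alg \<Rightarrow> _"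
  by (drule two_sided_ideal_uminus) (simp add: algebra_simps)

lift_definition minus_U_alg :: "U_alg \<Rightarrow> U_alg \<Rightarrow> U_alg" is "(-) :: free_alg \<Rightarrow> _"
proof -
  fix p p' q q' :: free_alg
  assume "p - p' \<in> two_sided_ideal relators" "q - q' \<in> two_sided_ideal relators"
  from two_sided_ideal.add[OF this(1) two_sided_ideal_uminus[OF this(2)]]
  show "p - q - (p' - q') \<in> two_sided_ideal relators"
    by (simp add: algebra_simps)
qed

lift_definition times_U_alg :: "U_alg \<Rightarrow> U_alg \<Rightarrow> U_alg" is "(*) :: free_alg \<Rightarrow> _"
proof -
  fix p p' q q' :: free_alg
  assume "p - p' \<in> two_sided_ideal relators" "q - q' \<in> two_sided_ideal relators"
  then have "1 * (p - p') * q + p' * (q - q') * 1 \<in> two_sided_ideal relators"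
    by (intro two_sided_ideal.add two_sided_ideal_mult)
  then show "p * q - p' * q' \<in> two_sided_ideal relators"
    by (simp add: algebra_simps)
qed

instance
proof
  have "(1 :: free_alg) \<notin> two_sided_ideal relators"
    using const_coeff_relators by fastforce
  then have "- (1 :: free_alg) \<notin> two_sided_ideal relators"
    using two_sided_ideal_uminus[of "- 1"] by auto
  then show "(0 :: U_alg) \<noteq> 1"
    by transfer simp
next
  fix a b c :: U_alg
  show "a + b + c = a + (b + c)" "a + b = b + a" "0 + a = a" "- a + a = 0" "a - b = a + - b"
    "a * b * c = a * (b * c)" "1 * a = a" "a * 1 = a"
    "(a + b) * c = a * c + b * c" "a * (b + c) = a * b + a * c"
    by (transfer, simp add: algebra_simps two_sided_ideal.zero)+
qed

end

lift_definition U_scale :: "complex \<Rightarrow> U_alg \<Rightarrow> U_alg" is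
  "\<lambda>c p. Poly_Mapping.single 0 c * p"
proof -
  fix c :: complex and p q :: free_alg
  assume "p - q \<in> two_sided_ideal relators"
  from two_sided_ideal_mult[OF this, of "Poly_Mapping.single 0 c" 1]
  show "Poly_Mapping.single 0 c * p - Poly_Mapping.single 0 c * q \<in> two_sided_ideal relators"
    by (simp add: algebra_simps)
qed

lift_definition U_gen :: "gen \<Rightarrow> U_alg" is free_gen .

lemma U_relations:
  "U_gen GX * U_gen GZ + U_gen GZ * U_gen GX = 2 * U_gen GX"
  "U_gen GY * U_gen GZ + U_gen GZ * U_gen GY = - 2 * U_gen GY"
  "(U_gen GX)\<^sup>2 - (U_gen GY)\<^sup>2 = U_gen GZ"
proof -
  have r: "s \<in> relators \<Longrightarrow> s = p - q \<Longrightarrow> p - q \<in> two_sided_ideal relators" for s p q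
    using two_sided_ideal_base by blast
  show "U_gen GX * U_gen GZ + U_gen GZ * U_gen GX = 2 * U_gen GX"
    unfolding mult_2
    by transfer (rule r[of "free_gen GX * free_gen GZ + free_gen GZ * free_gen GX - 2 * free_gen GX"],
      simp_all only: mult_2, simp_all add: relators_def Let_def mult_2)
  show "U_gen GY * U_gen GZ + U_gen GZ * U_gen GY = - 2 * U_gen GY"
    unfolding mult_minus_left mult_2
    by transfer (rule r[of "free_gen GY * free_gen GZ + free_gen GZ * free_gen GY - (- 2 * free_gen GY)"],
      simp_all only: mult_2 mult_minus_left, simp_all add: relators_def Let_def mult_2)
  show "(U_gen GX)\<^sup>2 - (U_gen GY)\<^sup>2 = U_gen GZ"
    unfolding power2_eq_square
    by transfer (rule r[of "(free_gen GX)\<^sup>2 - (free_gen GY)\<^sup>2 - free_gen GZ"],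
      simp_all add: relators_def Let_def power2_eq_square)
qed


section \<open>Modules over $U$\<close>

text \<open>
  The underlying complex vector space of a module is a subspace \<open>carr\<close> of an ambient type
  carrying the scalar multiplication \<open>scl\<close>, so that the dimension can depend on a parameter;
  \<open>carr = UNIV\<close> is allowed.
\<close>

record 'v U_mod =
  carr :: "'v set"
  scl :: "complex \<Rightarrow> 'v \<Rightarrow> 'v"
  act :: "U_alg \<Rightarrow> 'v \<Rightarrow> 'v"

locale U_module =
  fixes M :: "'v::ab_group_add U_mod"
  assumes vector_space: "vector_space (scl M)"
    and subspace: "module.subspace (scl M) (carr M)"
    and act_closed: "x \<in> carr M \<Longrightarrow> act M a x \<in> carr M"
    and act_add: "x \<in> carr M \<Longrightarrow> y \<in> carr M \<Longrightarrow> act M a (x + y) = act M a x + act M a y"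
    and act_scale: "x \<in> carr M \<Longrightarrow> act M a (scl M c x) = scl M c (act M a x)"
    and add_act: "x \<in> carr M \<Longrightarrow> act M (a + b) x = act M a x + act M b x"
    and scale_act: "x \<in> carr M \<Longrightarrow> act M (U_scale c a) x = scl M c (act M a x)"
    and mult_act: "x \<in> carr M \<Longrightarrow> act M (a * b) x = act M a (act M b x)"
    and one_act: "x \<in> carr M \<Longrightarrow> act M 1 x = x"

definition finite_dim_U_module :: "'v::ab_group_add U_mod \<Rightarrow> bool" where
  "finite_dim_U_module M \<longleftrightarrow> (\<exists>B. finite B \<and> module.span (scl M) B = carr M)"

definition U_submodule :: "'v::ab_group_add set \<Rightarrow> 'v U_mod \<Rightarrow> bool" where
  "U_submodule N M \<longleftrightarrow>
    N \<subseteq> carr M \<and> module.subspace (scl M) N \<and> (\<forall>a. \<forall>x\<in>N. act M a x \<in> N)"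

definition simple_U_module :: "'v::ab_group_add U_mod \<Rightarrow> bool" where
  "simple_U_module M \<longleftrightarrow>
    carr M \<noteq> {0} \<and> (\<forall>N. U_submodule N M \<longrightarrow> N = {0} \<or> N = carr M)"

definition U_isomorphic :: "'v::ab_group_add U_mod \<Rightarrow> 'w::ab_group_add U_mod \<Rightarrow> bool"
    (infix \<open>\<cong>\<^sub>U\<close> 50) where
  "M \<cong>\<^sub>U N \<longleftrightarrow>
    (\<exists>f. bij_betw f (carr M) (carr N) \<and>
      (\<forall>x\<in>carr M. \<forall>y\<in>carr M. f (x + y) = f x + f y) \<and>
      (\<forall>c. \<forall>x\<in>carr M. f (scl M c x) = scl N c (f x)) \<and>
      (\<forall>a. \<forall>x\<in>carr M. f (act M a x) = act N a (f x)))"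


section \<open>Modules given by the action of $X$, $Y$, $Z$ on a basis\<close>

datatype bas = V nat | W nat | Uu

type_synonym vec = "bas \<Rightarrow>\<^sub>0 complex"

definition smult :: "complex \<Rightarrow> ('b \<Rightarrow>\<^sub>0 complex) \<Rightarrow> ('b \<Rightarrow>\<^sub>0 complex)" where
  "smult c p = Poly_Mapping.map ((*) c) p"

definition linext :: "('a \<Rightarrow> ('b \<Rightarrow>\<^sub>0 complex)) \<Rightarrow> ('a \<Rightarrow>\<^sub>0 complex) \<Rightarrow> ('b \<Rightarrow>\<^sub>0 complex)" where
  "linext F p = (\<Sum>i\<in>Poly_Mapping.keys p. smult (Poly_Mapping.lookup p i) (F i))"

definition free_act :: "(gen \<Rightarrow> 'b \<Rightarrow> ('b \<Rightarrow>\<^sub>0 complex)) \<Rightarrow> free_alg \<Rightarrow>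
    ('b \<Rightarrow>\<^sub>0 complex) \<Rightarrow> ('b \<Rightarrow>\<^sub>0 complex)" where
  "free_act T p x = linext (\<lambda>w. foldr (\<lambda>g. linext (T g)) (letters w) x) p"

text \<open>
  An element of \<^typ>\<open>U_alg\<close> acts through an arbitrary representative in the free algebra. If the
  tables \<open>T\<close> satisfy the defining relations, the choice does not matter and the result is a
  module on which the generators act as tabulated: see \<open>table_module\<close> and
  \<open>act_gen_table_mod\<close> below.
\<close>

definition table_mod :: "'b set \<Rightarrow> (gen \<Rightarrow> 'b \<Rightarrow> ('b \<Rightarrow>\<^sub>0 complex)) \<Rightarrow> ('b \<Rightarrow>\<^sub>0 complex) U_mod" where
  "table_mod I T =
    \<lparr>carr = {x. Poly_Mapping.keys x \<subseteq> I}, scl = smult,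
     act = (\<lambda>a. free_act T (rep_U_alg a))\<rparr>"

definition bvec :: "'b \<Rightarrow> 'b \<Rightarrow>\<^sub>0 complex" where
  "bvec i = Poly_Mapping.single i 1"

definition ismult :: "int \<Rightarrow> ('b \<Rightarrow>\<^sub>0 complex) \<Rightarrow> 'b \<Rightarrow>\<^sub>0 complex" (infixr \<open>\<cdot>\<close> 75) where
  "k \<cdot> x = smult (of_int k) x"

lemma lookup_smult [simp]: "Poly_Mapping.lookup (smult c p) i = c * Poly_Mapping.lookup p i"
  by (auto simp: smult_def Poly_Mapping.map.rep_eq when_def)

lemma smult_simps [simp]:
  "smult c 0 = 0" "smult 0 p = 0" "smult 1 p = p" "smult c (smult d p) = smult (c * d) p"
  by (rule poly_mapping_eqI; simp)+

lemma smult_add_right: "smult c (p + q) = smult c p + smult c q"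
  by (rule poly_mapping_eqI) (simp add: lookup_add algebra_simps)

lemma smult_add_left: "smult (c + d) p = smult c p + smult d p"
  by (rule poly_mapping_eqI) (simp add: lookup_add algebra_simps)

lemma smult_sum: "smult c (sum f A) = (\<Sum>i\<in>A. smult c (f i))"
  by (induction A rule: infinite_finite_induct) (simp_all add: smult_add_right)

lemma vector_space_smult: "vector_space (smult :: complex \<Rightarrow> ('b \<Rightarrow>\<^sub>0 complex) \<Rightarrow> _)"
  by unfold_locales (simp_all add: smult_add_left smult_add_right)

lemma linext_superset:
  assumes "finite A" "Poly_Mapping.keys p \<subseteq> A"
  shows "linext F p = (\<Sum>i\<in>A. smult (Poly_Mapping.lookup p i) (F i))"
  unfolding linext_def
  by (rule sum.mono_neutral_left) (use assms in \<open>auto simp: in_keys_iff\<close>)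

lemma linext_add: "linext F (p + q) = linext F p + linext F q"
proof -
  define A where "A = Poly_Mapping.keys p \<union> Poly_Mapping.keys q"
  have A: "finite A" "Poly_Mapping.keys p \<subseteq> A" "Poly_Mapping.keys q \<subseteq> A"
    "Poly_Mapping.keys (p + q) \<subseteq> A"
    using keys_add[of p q] by (auto simp: A_def)
  show ?thesis
    by (simp add: linext_superset[OF A(1,2)] linext_superset[OF A(1,3)]
        linext_superset[OF A(1,4)] lookup_add smult_add_left sum.distrib)
qed

lemma linext_smult: "linext F (smult c p) = smult c (linext F p)"
proof -
  have "Poly_Mapping.keys (smult c p) \<subseteq> Poly_Mapping.keys p"
    by (auto simp: in_keys_iff)
  from linext_superset[OF _ this] show ?thesis
    by (simp add: linext_def smult_sum)
qed

lemma linext_0 [simp]: "linext F 0 = 0"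
  by (simp add: linext_def)

lemma linext_single [simp]: "linext F (Poly_Mapping.single i c) = smult c (F i)"
  by (cases "c = 0") (simp_all add: linext_def)

lemma linext_bvec [simp]: "linext F (bvec i) = F i"
  by (simp add: bvec_def)

lemma linext_sum: "linext F (sum f A) = (\<Sum>i\<in>A. linext F (f i))"
  by (induction A rule: infinite_finite_induct) (simp_all add: linext_add)

lemma poly_mapping_expansion:
  fixes p :: "'a \<Rightarrow>\<^sub>0 complex"
  shows "p = (\<Sum>i\<in>Poly_Mapping.keys p. Poly_Mapping.single i (Poly_Mapping.lookup p i))"
proof (rule poly_mapping_eqI)
  fix k :: 'a
  have "Poly_Mapping.lookup (\<Sum>i\<in>Poly_Mapping.keys p.
      Poly_Mapping.single i (Poly_Mapping.lookup p i)) k =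
      (\<Sum>i\<in>Poly_Mapping.keys p. if i = k then Poly_Mapping.lookup p i else 0)"
    by (simp add: lookup_sum lookup_single when_def)
  then show "Poly_Mapping.lookup p k = Poly_Mapping.lookup (\<Sum>i\<in>Poly_Mapping.keys p.
      Poly_Mapping.single i (Poly_Mapping.lookup p i)) k"
    by (simp add: in_keys_iff)
qed

lemma poly_mapping_linear_induct [case_names zero single add]:
  fixes p :: "'a \<Rightarrow>\<^sub>0 complex"
  assumes "P 0" "\<And>i c. P (Poly_Mapping.single i c)" "\<And>p q. P p \<Longrightarrow> P q \<Longrightarrow> P (p + q)"
  shows "P p"
proof -
  have "P (\<Sum>i\<in>A. Poly_Mapping.single i (Poly_Mapping.lookup p i))" if "finite A" for A
    using that by induction (use assms in auto)
  from this[of "Poly_Mapping.keys p"] show ?thesis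
    using poly_mapping_expansion[of p] by simp
qed

lemma free_act_add: "free_act T (p + q) x = free_act T p x + free_act T q x"
  by (simp add: free_act_def linext_add)

lemma free_act_zero [simp]: "free_act T 0 x = 0"
  by (simp add: free_act_def)

lemma free_act_single:
  "free_act T (Poly_Mapping.single w c) x = smult c (foldr (\<lambda>g. linext (T g)) (letters w) x)"
  by (simp add: free_act_def)

lemma free_act_uminus: "free_act T (- p) x = - free_act T p x"
  using free_act_add[of T p "- p" x] by (simp add: eq_neg_iff_add_eq_0 add.commute)

lemma free_act_diff: "free_act T (p - q) x = free_act T p x - free_act T q x"
  using free_act_add[of T p "- q" x] by (simp add: free_act_uminus)

lemma free_act_one [simp]: "free_act T 1 x = x"
  by (simp add: free_act_single zero_gword_def flip: single_one)

lemma free_act_gen [simp]: "free_act T (free_gen g) x = linext (T g) x"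
  by (simp add: free_gen_def free_act_single)

lemma foldr_linext_add:
  "foldr (\<lambda>g. linext (T g)) gs (x + y) =
    foldr (\<lambda>g. linext (T g)) gs x + foldr (\<lambda>g. linext (T g)) gs y"
  by (induction gs) (simp_all add: linext_add)

lemma foldr_linext_smult:
  "foldr (\<lambda>g. linext (T g)) gs (smult c x) = smult c (foldr (\<lambda>g. linext (T g)) gs x)"
  by (induction gs) (simp_all add: linext_smult)

lemma free_act_add_right: "free_act T p (x + y) = free_act T p x + free_act T p y"
  by (simp add: free_act_def linext_def foldr_linext_add smult_add_right sum.distrib)

lemma free_act_smult_right: "free_act T p (smult c x) = smult c (free_act T p x)"
  by (simp add: free_act_def linext_def foldr_linext_smult smult_sum mult.commute)

lemma free_act_zero_right [simp]: "free_act T p 0 = 0"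
  using free_act_smult_right[of T p 0 0] by simp

lemma free_act_mult: "free_act T (p * q) x = free_act T p (free_act T q x)"
proof (induction p rule: poly_mapping_linear_induct)
  case (single v c)
  show ?case
  proof (induction q rule: poly_mapping_linear_induct)
    case (single w d)
    show ?case
      by (simp add: mult_single free_act_single plus_gword_def foldr_linext_smult)
  qed (simp_all add: distrib_left free_act_add free_act_add_right)
qed (simp_all add: distrib_right free_act_add)

lemma keys_smult: "Poly_Mapping.keys (smult c p) \<subseteq> Poly_Mapping.keys p"
  by (auto simp: in_keys_iff)

lemma keys_sum_subset:
  "(\<And>i. i \<in> A \<Longrightarrow> Poly_Mapping.keys (f i) \<subseteq> I) \<Longrightarrow> Poly_Mapping.keys (sum f A) \<subseteq> I"
proof (induction A rule: infinite_finite_induct)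
  case (insert a A)
  then show ?case
    using keys_add[of "f a" "sum f A"] by auto
qed simp_all

lemma keys_linext:
  assumes "\<And>i. i \<in> Poly_Mapping.keys p \<Longrightarrow> Poly_Mapping.keys (F i) \<subseteq> I"
  shows "Poly_Mapping.keys (linext F p) \<subseteq> I"
  unfolding linext_def
  by (rule keys_sum_subset, rule order_trans[OF keys_smult], rule assms)

locale U_table =
  fixes I :: "'b set" and T :: "gen \<Rightarrow> 'b \<Rightarrow> ('b \<Rightarrow>\<^sub>0 complex)"
  assumes closed: "i \<in> I \<Longrightarrow> Poly_Mapping.keys (T g i) \<subseteq> I"
    and XZ: "i \<in> I \<Longrightarrow> linext (T GX) (T GZ i) + linext (T GZ) (T GX i) = 2 \<cdot> T GX i"
    and YZ: "i \<in> I \<Longrightarrow> linext (T GY) (T GZ i) + linext (T GZ) (T GY i) = (-2) \<cdot> T GY i"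
    and XY: "i \<in> I \<Longrightarrow> linext (T GX) (T GX i) = linext (T GY) (T GY i) + T GZ i"
begin

lemma free_act_closed:
  assumes "Poly_Mapping.keys x \<subseteq> I"
  shows "Poly_Mapping.keys (free_act T p x) \<subseteq> I"
  unfolding free_act_def
proof (rule keys_linext)
  fix w
  show "Poly_Mapping.keys (foldr (\<lambda>g. linext (T g)) (letters w) x) \<subseteq> I"
  proof (induction "letters w" arbitrary: w)
    case Nil
    then show ?case using assms by simp
  next
    case (Cons g gs)
    have "Poly_Mapping.keys (foldr (\<lambda>g. linext (T g)) gs x) \<subseteq> I"
      using Cons.hyps(1)[of "Word gs"] by simp
    then have "Poly_Mapping.keys (linext (T g) (foldr (\<lambda>g. linext (T g)) gs x)) \<subseteq> I"
      by (intro keys_linext closed) blast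
    then show ?case
      by (simp flip: Cons.hyps(2))
  qed
qed

lemma free_act_expansion:
  "free_act T p x =
    (\<Sum>i\<in>Poly_Mapping.keys x. smult (Poly_Mapping.lookup x i) (free_act T p (bvec i)))"
proof -
  have "free_act T p (sum f A) = (\<Sum>i\<in>A. free_act T p (f i))" for f :: "'b \<Rightarrow> _" and A
    by (induction A rule: infinite_finite_induct) (simp_all add: free_act_add_right)
  then have "free_act T p (\<Sum>i\<in>Poly_Mapping.keys x. smult (Poly_Mapping.lookup x i) (bvec i)) =
      (\<Sum>i\<in>Poly_Mapping.keys x. smult (Poly_Mapping.lookup x i) (free_act T p (bvec i)))"
    by (simp add: free_act_smult_right)
  moreover have "smult (Poly_Mapping.lookup x i) (bvec i) =
      Poly_Mapping.single i (Poly_Mapping.lookup x i)" for i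
    by (rule poly_mapping_eqI) (simp add: bvec_def lookup_single when_def)
  ultimately show ?thesis
    using poly_mapping_expansion[of x] by simp
qed

lemma free_act_relator:
  assumes "r \<in> relators" "Poly_Mapping.keys x \<subseteq> I"
  shows "free_act T r x = 0"
proof -
  have s2: "smult 2 y = y + y" "smult (- 2) y = - y - y" for y :: "'b \<Rightarrow>\<^sub>0 complex"
    by (rule poly_mapping_eqI; simp add: lookup_add lookup_minus)+
  have "free_act T r (bvec i) = 0" if "i \<in> I" for i
    using assms(1) XZ[OF that, unfolded ismult_def] YZ[OF that, unfolded ismult_def] XY[OF that]
    by (auto simp: relators_def Let_def free_act_diff free_act_add free_act_uminus free_act_mult
        mult_2 power2_eq_square s2)
  then have "smult (Poly_Mapping.lookup x i) (free_act T r (bvec i)) = 0"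
    if "i \<in> Poly_Mapping.keys x" for i
    using assms(2) that by auto
  then show ?thesis
    by (subst free_act_expansion) (rule sum.neutral, blast)
qed

lemma free_act_ideal:
  assumes "p \<in> two_sided_ideal relators" "Poly_Mapping.keys x \<subseteq> I"
  shows "free_act T p x = 0"
  using assms
  by (induction rule: two_sided_ideal.induct)
    (simp_all add: free_act_add free_act_mult free_act_relator free_act_closed)

lemma act_table_mod:
  assumes "Poly_Mapping.keys x \<subseteq> I"
  shows "act (table_mod I T) (abs_U_alg p) x = free_act T p x"
proof -
  have "rep_U_alg (abs_U_alg p) - p \<in> two_sided_ideal relators"
    using Quotient3_U_alg rep_abs_rsp_left[OF Quotient3_U_alg, of p p]
    by (simp add: two_sided_ideal.zero)
  from free_act_ideal[OF this assms] show ?thesis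
    by (simp add: table_mod_def free_act_diff)
qed

lemma act_gen_table_mod:
  "Poly_Mapping.keys x \<subseteq> I \<Longrightarrow> act (table_mod I T) (U_gen g) x = linext (T g) x"
  by (simp add: U_gen.abs_eq act_table_mod)

theorem table_module: "U_module (table_mod I T)"
proof -
  interpret vector_space "smult :: complex \<Rightarrow> ('b \<Rightarrow>\<^sub>0 complex) \<Rightarrow> _"
    by (rule vector_space_smult)
  have carr: "x \<in> carr (table_mod I T) \<longleftrightarrow> Poly_Mapping.keys x \<subseteq> I" for x
    by (simp add: table_mod_def)
  have scl: "scl (table_mod I T) = smult"
    by (simp add: table_mod_def)
  have ex: "\<exists>p. a = abs_U_alg p" for a
    by (metis Quotient3_abs_rep Quotient3_U_alg)
  show ?thesis
  proof (rule U_module.intro)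
    show "module.subspace (scl (table_mod I T)) (carr (table_mod I T))"
      unfolding scl
    proof (rule subspaceI)
      show "x + y \<in> carr (table_mod I T)"
        if "x \<in> carr (table_mod I T)" "y \<in> carr (table_mod I T)" for x y
        using that keys_add[of x y] by (auto simp: carr)
      show "smult c x \<in> carr (table_mod I T)" if "x \<in> carr (table_mod I T)" for c x
        using that keys_smult[of c x] by (auto simp: carr)
    qed (simp add: carr)
    show "vector_space (scl (table_mod I T))"
      unfolding scl by (rule vector_space_smult)
  next
    fix x y :: "'b \<Rightarrow>\<^sub>0 complex" and a b c
    assume x: "x \<in> carr (table_mod I T)"
    obtain p q where p: "a = abs_U_alg p" and q: "b = abs_U_alg q"
      using ex by meson
    note [simp] = x[unfolded carr] act_table_mod carr scl p q free_act_closed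
    show "act (table_mod I T) a x \<in> carr (table_mod I T)"
      by simp
    show "act (table_mod I T) a (scl (table_mod I T) c x) =
        scl (table_mod I T) c (act (table_mod I T) a x)"
      using order_trans[OF keys_smult[of c x]] x by (simp add: free_act_smult_right)
    show "act (table_mod I T) (a + b) x = act (table_mod I T) a x + act (table_mod I T) b x"
      by (simp add: plus_U_alg.abs_eq free_act_add)
    show "act (table_mod I T) (a * b) x = act (table_mod I T) a (act (table_mod I T) b x)"
      by (simp add: times_U_alg.abs_eq free_act_mult)
    show "act (table_mod I T) (U_scale c a) x =
        scl (table_mod I T) c (act (table_mod I T) a x)"
      by (simp add: U_scale.abs_eq free_act_mult free_act_single zero_gword_def)
    show "act (table_mod I T) 1 x = x"
      by (simp add: one_U_alg_def)
    assume y: "y \<in> carr (table_mod I T)"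
    then show "act (table_mod I T) a (x + y) = act (table_mod I T) a x + act (table_mod I T) a y"
      using order_trans[OF keys_add[of x y], of I] x by (simp add: free_act_add_right)
  qed
qed

end


section \<open>The modules $E_n$, $A_n^\pm$, $B_n^\pm$\<close>

definition vec_v :: "nat \<Rightarrow> vec" where
  "vec_v k = bvec (V k)"

definition tables :: "('b \<Rightarrow> 'c) \<Rightarrow> ('b \<Rightarrow> 'c) \<Rightarrow> ('b \<Rightarrow> 'c) \<Rightarrow> gen \<Rightarrow> 'b \<Rightarrow> 'c" where
  "tables X Y Z g = (case g of GX \<Rightarrow> X | GY \<Rightarrow> Y | GZ \<Rightarrow> Z)"

text \<open>
  The indices of the vectors \<open>w\<close> are integers because of the conventions for the index $-1$.
  Values of the tables outside the respective bases are irrelevant.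
\<close>

definition E_w :: "nat \<Rightarrow> int \<Rightarrow> vec" where
  "E_w n k = (if 0 \<le> k \<and> k < int n then bvec (W (nat k)) else 0)"

fun E_X :: "nat \<Rightarrow> bas \<Rightarrow> vec" where
  "E_X n (V k) = E_w n (int k)"
| "E_X n (W k) = (2 * int n + int k * (4 * int n - 2 - 4 * int k)) \<cdot> vec_v k"
| "E_X n Uu = 0"

fun E_Y :: "nat \<Rightarrow> bas \<Rightarrow> vec" where
  "E_Y n (V k) = (int k * (4 * int n + 2 - 4 * int k)) \<cdot> E_w n (int k - 1)"
| "E_Y n (W k) = vec_v (k + 1)"
| "E_Y n Uu = 0"

fun E_Z :: "nat \<Rightarrow> bas \<Rightarrow> vec" where
  "E_Z n (V k) = (2 * int n - 4 * int k) \<cdot> vec_v k"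
| "E_Z n (W k) = (4 * int k + 2 - 2 * int n) \<cdot> E_w n (int k)"
| "E_Z n Uu = 0"

definition E_mod :: "nat \<Rightarrow> vec U_mod" where
  "E_mod n = table_mod (V ` {..n} \<union> W ` {..<n}) (tables (E_X n) (E_Y n) (E_Z n))"

text \<open>
  In $A_n^\pm$ and $B_n^\pm$ the vectors $w_j = v_{n-1-j}$ are again basis vectors. Hence a table
  entry for $v_k$ with $k$ in the upper half of the range is the formula for $w_j$ with
  $j = n - 1 - k$. The middle entry, $k = m$ where $m$ is \<open>n div 2\<close>, is the one
  depending on the sign \<open>s\<close>; it belongs to $Y$ for even $n$ and to $X$ for odd $n$. For $B_0^\pm$ the sign is in the entry
  of $Y$ for the only basis vector $u$ (\<open>Uu\<close>).
\<close>

definition A_w :: "nat \<Rightarrow> int \<Rightarrow> vec" where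
  "A_w n k = (if k < 0 then 0 else vec_v (n - 1 - nat k))"

fun A_X :: "nat \<Rightarrow> int \<Rightarrow> bas \<Rightarrow> vec" where
  "A_X n s (V k) =
    (if k < n div 2 then A_w n (int k)
     else if odd n \<and> k = n div 2 then (s * int n) \<cdot> vec_v k
     else let j = n - 1 - k in (2 * int n - 1 + 4 * int j * (int n - int j - 1)) \<cdot> vec_v j)"
| "A_X n s _ = 0"

fun A_Y :: "nat \<Rightarrow> int \<Rightarrow> bas \<Rightarrow> vec" where
  "A_Y n s (V k) =
    (if even n \<and> k = n div 2 then (s * int n) \<cdot> vec_v k
     else if k \<le> n div 2 then (4 * int k * (int n - int k)) \<cdot> A_w n (int k - 1)
     else let j = n - 1 - k in vec_v (j + 1))"
| "A_Y n s _ = 0"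

fun A_Z :: "nat \<Rightarrow> bas \<Rightarrow> vec" where
  "A_Z n (V k) = (2 * int n - 1 - 4 * int k) \<cdot> vec_v k"
| "A_Z n _ = 0"

definition A_mod :: "nat \<Rightarrow> int \<Rightarrow> vec U_mod" where
  "A_mod n s = table_mod (V ` {..<n}) (tables (A_X n s) (A_Y n s) (A_Z n))"

definition B_w :: "nat \<Rightarrow> int \<Rightarrow> vec" where
  "B_w n k = (if k < 0 then bvec Uu else vec_v (n - 1 - nat k))"

fun B_X :: "nat \<Rightarrow> int \<Rightarrow> bas \<Rightarrow> vec" where
  "B_X n s (V k) =
    (if k < n div 2 then B_w n (int k)
     else if odd n \<and> k = n div 2 then (s * (int n + 1)) \<cdot> vec_v k
     else let j = n - 1 - k in (4 * int n + 4 * int j * (int n - int j - 1)) \<cdot> vec_v j)"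
| "B_X n s _ = 0"

fun B_Y :: "nat \<Rightarrow> int \<Rightarrow> bas \<Rightarrow> vec" where
  "B_Y n s (V k) =
    (if even n \<and> k = n div 2 then (s * (int n + 1)) \<cdot> vec_v k
     else if k \<le> n div 2 then (2 * int n + 1 + 4 * int k * (int n - int k)) \<cdot> B_w n (int k - 1)
     else let j = n - 1 - k in vec_v (j + 1))"
| "B_Y n s Uu = (if n = 0 then s \<cdot> bvec Uu else vec_v 0)"
| "B_Y n s (W k) = 0"

fun B_Z :: "nat \<Rightarrow> bas \<Rightarrow> vec" where
  "B_Z n (V k) = (2 * int n - 1 - 4 * int k) \<cdot> vec_v k"
| "B_Z n Uu = (- 2 * int n - 1) \<cdot> bvec Uu"
| "B_Z n (W k) = 0"

definition B_mod :: "nat \<Rightarrow> int \<Rightarrow> vec U_mod" where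
  "B_mod n s = table_mod (insert Uu (V ` {..<n})) (tables (B_X n s) (B_Y n s) (B_Z n))"

lemma linext_ismult [simp]: "linext F (k \<cdot> x) = k \<cdot> linext F x"
  by (simp add: ismult_def linext_smult)

lemma linext_v [simp]: "linext F (vec_v k) = F (V k)"
  by (simp add: vec_v_def)

lemma ismult_simps:
  "0 \<cdot> x = 0" "k \<cdot> 0 = 0" "k \<cdot> l \<cdot> x = (k * l) \<cdot> x"
  "k \<cdot> x + l \<cdot> x = (k + l) \<cdot> x" "x + l \<cdot> x = (1 + l) \<cdot> x" "l \<cdot> x + x = (l + 1) \<cdot> x"
  unfolding ismult_def by (rule poly_mapping_eqI; simp add: lookup_add algebra_simps)+

lemma ismult_eqI:
  "k = l \<Longrightarrow> k \<cdot> x = l \<cdot> x" "k = 1 \<Longrightarrow> k \<cdot> x = x" "1 = l \<Longrightarrow> x = l \<cdot> x"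
  "k = 0 \<Longrightarrow> k \<cdot> x = 0" "0 = l \<Longrightarrow> 0 = l \<cdot> x"
  by (simp_all add: ismult_def)

lemma keys_subset_simps:
  "i \<in> I \<Longrightarrow> Poly_Mapping.keys (bvec i) \<subseteq> I"
  "V k \<in> I \<Longrightarrow> Poly_Mapping.keys (vec_v k) \<subseteq> I"
  "Poly_Mapping.keys x \<subseteq> I \<Longrightarrow> Poly_Mapping.keys (l \<cdot> x) \<subseteq> I"
  by (simp_all add: vec_v_def bvec_def ismult_def order_trans[OF keys_smult])

lemma tables_simps [simp]:
  "tables X Y Z GX = X" "tables X Y Z GY = Y" "tables X Y Z GZ = Z"
  by (simp_all add: tables_def)

lemma bas_image_iff:
  "V k \<in> V ` A \<longleftrightarrow> k \<in> A" "W k \<in> W ` A \<longleftrightarrow> k \<in> A" "V k \<notin> W ` A" "W k \<notin> V ` A"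
  by auto

lemma E_table: "U_table (V ` {..n} \<union> W ` {..<n}) (tables (E_X n) (E_Y n) (E_Z n))"
proof
  fix i g
  assume i: "i \<in> V ` {..n} \<union> W ` {..<n}"
  let ?T = "tables (E_X n) (E_Y n) (E_Z n)"
  consider k where "i = V k" "0 < k" "k < n" | "i = V 0" "0 < n" | "i = V n" "0 < n" | "i = V 0" "n = 0" | k where "i = W k" "k < n"
  proof -
    from i consider k where "i = V k" "k \<le> n" | k where "i = W k" "k < n"
      by auto
    then show ?thesis
    proof cases
      case (1 k)
      then show ?thesis
        using that(1)[of k] that(2,3,4) by (cases "k = 0"; cases "k = n"; simp)
    qed (rule that(5))
  qed
  note cs = this
  show "Poly_Mapping.keys (tables (E_X n) (E_Y n) (E_Z n) g i) \<subseteq> V ` {..n} \<union> W ` {..<n}"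
    by (rule cs; cases g; simp add: E_w_def ismult_simps keys_subset_simps bas_image_iff nat_less_iff)
  show "linext (?T GX) (?T GZ i) + linext (?T GZ) (?T GX i) = 2 \<cdot> ?T GX i"
    by (rule cs; simp add: E_w_def ismult_simps; (rule ismult_eqI, simp add: algebra_simps)?)
  show "linext (?T GY) (?T GZ i) + linext (?T GZ) (?T GY i) = (-2) \<cdot> ?T GY i"
    by (rule cs; simp add: E_w_def ismult_simps nat_diff_distrib of_nat_diff; (rule ismult_eqI, simp add: algebra_simps)?)
  show "linext (?T GX) (?T GX i) = linext (?T GY) (?T GY i) + ?T GZ i"
    by (rule cs; simp add: E_w_def ismult_simps nat_diff_distrib of_nat_diff; (rule ismult_eqI, simp add: algebra_simps)?)
qed

lemma A_X_V:
  assumes "k < n"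
  shows "A_X n s (V k) =
    (if 2 * k + 1 < n then vec_v (n - 1 - k) else if 2 * k + 1 = n then (s * int n) \<cdot> vec_v k
     else (2 * int n - 1 + 4 * (int n - 1 - int k) * int k) \<cdot> vec_v (n - 1 - k))"
proof -
  have "k < n div 2 \<longleftrightarrow> 2 * k + 1 < n" "odd n \<and> k = n div 2 \<longleftrightarrow> 2 * k + 1 = n"
    by (presburger, presburger)
  moreover have "int (n - 1 - k) = int n - 1 - int k"
    using assms by simp
  ultimately show ?thesis
    by (simp add: A_w_def Let_def del: of_nat_diff)
qed

lemma A_Y_V:
  assumes "k < n"
  shows "A_Y n s (V k) =
    (if 2 * k < n then (4 * int k * (int n - int k)) \<cdot> vec_v (n - k)
     else if 2 * k = n then (s * int n) \<cdot> vec_v k else vec_v (n - k))"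
proof -
  have "n - Suc (nat (int k - 1)) = n - k" if "0 < k"
    using that by simp
  moreover have "Suc (n - Suc k) = n - k"
    using assms by simp
  moreover have "even n \<and> k = n div 2 \<longleftrightarrow> 2 * k = n" "k \<le> n div 2 \<longleftrightarrow> 2 * k \<le> n"
    by (presburger, presburger)
  ultimately show ?thesis
    by (auto simp: A_w_def Let_def ismult_simps)
qed

lemma A_XX:
  assumes "k < n" "s * s = 1"
  shows "linext (A_X n s) (A_X n s (V k)) = (2 * int n - 1 + 4 * int k * (int n - 1 - int k)) \<cdot> vec_v k"
proof -
  consider d where "n = 2 * k + 2 + d" | "n = 2 * k + 1" | j d where "k = j + 1 + d" "n = j + k + 1"
  proof -
    have "n = 2 * k + 2 + (n - 2 * k - 2) \<or> n = 2 * k + 1 \<or>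
        k = (n - 1 - k) + 1 + (2 * k - n) \<and> n = (n - 1 - k) + k + 1"
      using assms(1) by presburger
    then show ?thesis using that by blast
  qed
  then show ?thesis
  proof cases
    case 2
    have ss: "s * (s * a) = a" for a
      using assms(2) by (simp flip: mult.assoc)
    from 2 show ?thesis
      by (simp add: A_X_V ismult_simps ss assms(2) algebra_simps del: A_X.simps(1))
  qed (simp_all add: A_X_V ismult_simps algebra_simps del: A_X.simps(1))
qed

lemma A_YY:
  assumes "k < n" "s * s = 1"
  shows "linext (A_Y n s) (A_Y n s (V k)) = (4 * int k * (int n - int k)) \<cdot> vec_v k"
proof -
  consider "k = 0" "n > 0" | d where "n = 2 * k + 1 + d" "k > 0" | "n = 2 * k" "k > 0"
    | j d where "k = j + 2 + d" "n = j + 1 + k"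
  proof -
    have "k = 0 \<and> n > 0 \<or> n = 2 * k + 1 + (n - 2 * k - 1) \<and> k > 0 \<or> n = 2 * k \<and> k > 0 \<or>
        k = (n - k - 1) + 2 + (2 * k - n - 1) \<and> n = (n - k - 1) + 1 + k"
      using assms(1) by presburger
    then show ?thesis using that by blast
  qed
  then show ?thesis
  proof cases
    case 3
    have ss: "s * (s * a) = a" for a
      using assms(2) by (simp flip: mult.assoc)
    from 3 show ?thesis
      by (simp add: A_Y_V ismult_simps ss assms(2) algebra_simps del: A_Y.simps(1))
  qed (simp_all add: A_Y_V ismult_simps algebra_simps del: A_Y.simps(1))
qed

lemma A_table:
  assumes "s = 1 \<or> s = -1"
  shows "U_table (V ` {..<n}) (tables (A_X n s) (A_Y n s) (A_Z n))"
proof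
  fix i g
  let ?T = "tables (A_X n s) (A_Y n s) (A_Z n)"
  assume "i \<in> V ` {..<n}"
  then obtain k where i: "i = V k" "k < n" by auto
  have ss: "s * s = 1" "s * (s * a) = a" for a using assms by auto
  note tab = A_X_V A_Y_V ismult_simps of_nat_diff 
  show "Poly_Mapping.keys (?T g i) \<subseteq> V ` {..<n}"
    using i by (cases g; cases "k = 0") (simp_all add: tab keys_subset_simps bas_image_iff del: A_X.simps A_Y.simps)
  consider (lt) "2 * k + 1 < n" | (eq) "n = 2 * k + 1" | (gt) "n < 2 * k + 1"
    by linarith
  note Xc = this
  consider (z) "k = 0" | (lt) "2 * k < n" "k > 0" | (eq) "n = 2 * k" | (gt) "n < 2 * k"
    by linarith
  note Yc = this
  show "linext (?T GX) (?T GZ i) + linext (?T GZ) (?T GX i) = 2 \<cdot> ?T GX i"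
    by (insert i, (cases rule: Xc; simp add: tab del: A_X.simps A_Y.simps; ((rule ismult_eqI, simp add: algebra_simps; fail) | (rule ismult_eqI, algebra))?))
  show "linext (?T GY) (?T GZ i) + linext (?T GZ) (?T GY i) = (-2) \<cdot> ?T GY i"
    by (insert i, (cases rule: Yc; simp add: tab del: A_X.simps A_Y.simps; ((rule ismult_eqI, simp add: algebra_simps; fail) | (rule ismult_eqI, algebra))?))
  show "linext (?T GX) (?T GX i) = linext (?T GY) (?T GY i) + ?T GZ i"
    using i ss(1) A_XX[of k n s] A_YY[of k n s]
    by (simp add: ismult_simps algebra_simps del: A_X.simps A_Y.simps)
qed

lemma B_X_V:
  assumes "k < n"
  shows "B_X n s (V k) =
    (if 2 * k + 1 < n then vec_v (n - 1 - k) else if 2 * k + 1 = n then (s * (int n + 1)) \<cdot> vec_v k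
     else (4 * int n + 4 * (int n - 1 - int k) * int k) \<cdot> vec_v (n - 1 - k))"
proof -
  have "k < n div 2 \<longleftrightarrow> 2 * k + 1 < n" "odd n \<and> k = n div 2 \<longleftrightarrow> 2 * k + 1 = n"
    by (presburger, presburger)
  moreover have "int (n - 1 - k) = int n - 1 - int k"
    using assms by simp
  ultimately show ?thesis
    by (simp add: B_w_def Let_def del: of_nat_diff)
qed

lemma B_Y_V:
  assumes "k < n"
  shows "B_Y n s (V k) =
    (if k = 0 then (2 * int n + 1) \<cdot> bvec Uu
     else if 2 * k < n then (2 * int n + 1 + 4 * int k * (int n - int k)) \<cdot> vec_v (n - k)
     else if 2 * k = n then (s * (int n + 1)) \<cdot> vec_v k else vec_v (n - k))"
proof -
  have "n - Suc (nat (int k - 1)) = n - k" if "0 < k"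
    using that by simp
  moreover have "Suc (n - Suc k) = n - k"
    using assms by simp
  moreover have "even n \<and> k = n div 2 \<longleftrightarrow> 2 * k = n" "k \<le> n div 2 \<longleftrightarrow> 2 * k \<le> n"
    by (presburger, presburger)
  ultimately show ?thesis
    using assms by (auto simp: B_w_def Let_def ismult_simps)
qed

lemma B_XX:
  assumes "k < n" "s * s = 1"
  shows "linext (B_X n s) (B_X n s (V k)) = (4 * int n + 4 * int k * (int n - 1 - int k)) \<cdot> vec_v k"
proof -
  consider d where "n = 2 * k + 2 + d" | "n = 2 * k + 1" | j d where "k = j + 1 + d" "n = j + k + 1"
  proof -
    have "n = 2 * k + 2 + (n - 2 * k - 2) \<or> n = 2 * k + 1 \<or>
        k = (n - 1 - k) + 1 + (2 * k - n) \<and> n = (n - 1 - k) + k + 1"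
      using assms(1) by presburger
    then show ?thesis using that by blast
  qed
  then show ?thesis
  proof cases
    case 2
    have ss: "s * (s * a) = a" for a
      using assms(2) by (simp flip: mult.assoc)
    from 2 show ?thesis
      by (simp add: B_X_V ismult_simps ss assms(2) algebra_simps del: B_X.simps(1))
  qed (simp_all add: B_X_V ismult_simps algebra_simps del: B_X.simps(1))
qed

lemma B_YY:
  assumes "k < n" "s * s = 1"
  shows "linext (B_Y n s) (B_Y n s (V k)) = (2 * int n + 1 + 4 * int k * (int n - int k)) \<cdot> vec_v k"
proof -
  consider "k = 0" "n > 0" | d where "n = 2 * k + 1 + d" "k > 0" | "n = 2 * k" "k > 0"
    | j d where "k = j + 2 + d" "n = j + 1 + k"
  proof -
    have "k = 0 \<and> n > 0 \<or> n = 2 * k + 1 + (n - 2 * k - 1) \<and> k > 0 \<or> n = 2 * k \<and> k > 0 \<or>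
        k = (n - k - 1) + 2 + (2 * k - n - 1) \<and> n = (n - k - 1) + 1 + k"
      using assms(1) by presburger
    then show ?thesis using that by blast
  qed
  then show ?thesis
  proof cases
    case 3
    have ss: "s * (s * a) = a" for a
      using assms(2) by (simp flip: mult.assoc)
    from 3 show ?thesis
      by (simp add: B_Y_V ismult_simps ss assms(2) algebra_simps del: B_Y.simps(1))
  qed (simp_all add: B_Y_V ismult_simps algebra_simps del: B_Y.simps(1))
qed

lemma B_table:
  assumes "s = 1 \<or> s = -1"
  shows "U_table (insert Uu (V ` {..<n})) (tables (B_X n s) (B_Y n s) (B_Z n))"
proof
  fix i g
  let ?T = "tables (B_X n s) (B_Y n s) (B_Z n)"
  assume "i \<in> insert Uu (V ` {..<n})"
  then consider (U0) "i = Uu" "n = 0" | (U) "i = Uu" "n > 0" | (V) k where "i = V k" "k < n"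
    by auto
  note i = this
  have ss: "s * s = 1" "s * (s * a) = a" for a using assms by auto
  note tab = B_X_V B_Y_V ismult_simps of_nat_diff
  note del = B_X.simps(1) B_Y.simps(1)
  have Xc: thesis if "2 * k + 1 < n \<Longrightarrow> thesis" "n = 2 * k + 1 \<Longrightarrow> thesis" "n < 2 * k + 1 \<Longrightarrow> thesis" for k thesis
    using that by linarith
  have Yc: thesis if "k = 0 \<Longrightarrow> thesis" "2 * k < n \<Longrightarrow> k > 0 \<Longrightarrow> thesis" "n = 2 * k \<Longrightarrow> k > 0 \<Longrightarrow> thesis" "n < 2 * k \<Longrightarrow> k > 0 \<Longrightarrow> thesis" for k thesis
    using that by linarith
  show "Poly_Mapping.keys (?T g i) \<subseteq> insert Uu (V ` {..<n})"
    by (cases rule: i; cases g) (simp_all add: tab keys_subset_simps bas_image_iff del: del)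
  have bl: "linext F (bvec Uu) = F Uu" for F :: "bas \<Rightarrow> vec" by simp
  show "linext (?T GX) (?T GZ i) + linext (?T GZ) (?T GX i) = 2 \<cdot> ?T GX i"
  proof (cases rule: i)
    case (V k)
    show ?thesis
      by (insert V, (cases rule: Xc[of k]; simp add: tab del: del; ((rule ismult_eqI, simp add: algebra_simps; fail) | (rule ismult_eqI, algebra))?))
  qed (simp_all add: tab)
  show "linext (?T GY) (?T GZ i) + linext (?T GZ) (?T GY i) = (-2) \<cdot> ?T GY i"
  proof (cases rule: i)
    case (V k)
    show ?thesis
      by (insert V, (cases rule: Yc[of k]; simp add: tab del: del; ((rule ismult_eqI, simp add: algebra_simps; fail) | (rule ismult_eqI, algebra))?))
  qed (simp add: tab del: del; ((rule ismult_eqI, simp add: algebra_simps; fail) | (rule ismult_eqI, algebra))?)+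
  show "linext (?T GX) (?T GX i) = linext (?T GY) (?T GY i) + ?T GZ i"
  proof (cases rule: i)
    case (V k)
    then show ?thesis
      using ss(1) B_XX[of k n s] B_YY[of k n s]
      by (simp add: ismult_simps algebra_simps del: del)
  qed (simp add: tab ss del: del; ((rule ismult_eqI, simp add: ss algebra_simps; fail) | (rule ismult_eqI, algebra))?)+
qed
corollary U_module_E_mod: "U_module (E_mod n)"
  unfolding E_mod_def by (rule U_table.table_module[OF E_table])

corollary U_module_A_mod: "s = 1 \<or> s = -1 \<Longrightarrow> U_module (A_mod n s)"
  unfolding A_mod_def by (rule U_table.table_module[OF A_table])

corollary U_module_B_mod: "s = 1 \<or> s = -1 \<Longrightarrow> U_module (B_mod n s)"
  unfolding B_mod_def by (rule U_table.table_module[OF B_table])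

end

theory Submission
  imports Defs "HOL-Computational_Algebra.Fundamental_Theorem_Algebra"
begin

text \<open>
  Call an eigenvector of $Z$ a weight vector. The relations say that $X$ maps weight $\<mu>$ to
  weight $2 - \<mu>$ and $Y$ maps weight $\<mu>$ to weight $-2 - \<mu>$, so $XY$ raises weights
  by $4$. As a finite-dimensional module has only finitely many weights, some non-zero weight
  vector $x$ is killed by $X$ or by $Y$ (lemma \<open>exists_chain_start\<close>). The relations are
  preserved by exchanging $X$ with $Y$ and $Z$ with $-Z$ (lemma \<open>XYZ_rep_swap\<close>), so it is
  enough to understand $Yx = 0$.

  Let $x_0 = x$ have weight $\<kappa>$ and put $x_{i+1} = T_i x_i$, where $T_i$ is $X$ for even $i$ and
  $Y$ for odd $i$. Then $x_i$ has weight $\pm(\<kappa> - 2i)$, and the relation $X^2 = Y^2 + Z$ gives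
  $T_i x_{i+1} = (i+1)(\<kappa>-i) x_i$ as in the representation theory of $\mathfrak{sl}_2$
  (lemma \<open>step_chain_Suc\<close>). The chain stops: if $x_N \neq 0 = x_{N+1}$, this formula
  forces $\<kappa> = N$. There are two cases.

  If $N = 2n$ is even, the weights of $x_0, \ldots, x_N$ are pairwise different, and the action on
  the chain is that on the basis $v_0, w_0, v_1, w_1, \ldots, v_n$ of $E_n$.

  If $N = 2n - 1$ is odd, the weights of $x_i$ and $x_{N-i}$ coincide, and the span of the chain
  is the sum of the spans of two chains of half the length. They are found from the middle: $T_{n-1}$ exchanges $x_{n-1}$ and $x_n$ up to the factors $1$ and $n^2$, so it has an
  eigenvector for the eigenvalue $n$ or $-n$. It is the element with index $n - 1$ of the chain that
  starts at a suitable combination of $x_0$ and $x_N$ (lemma \<open>folded_chain\<close>). The first $n$ elements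
  of that chain are the basis of $A_n^\pm$ in the order $v_0, w_0, v_1, w_1, \ldots$. After exchanging $X$ and $Y$
  the same argument gives $B_{n-1}^\pm$, whose chain starts with $u$.

  In each case the linear extension of the map sending basis vectors to chain elements is a
  homomorphism from the table module to the given one; it is injective since
  the weights are different, and surjective by simplicity
  (lemma \<open>isomorphic_table_mod\<close>).
\<close>


section \<open>Eigenvectors of an endomorphism of a finite-dimensional subspace\<close>

locale subspace_endo = vector_space scale
  for scale :: "complex \<Rightarrow> 'v::ab_group_add \<Rightarrow> 'v" (infixr \<open>*s\<close> 75) +
  fixes S :: "'v set" and T :: "'v \<Rightarrow> 'v"
  assumes subspace_S: "subspace S"
    and closed: "x \<in> S \<Longrightarrow> T x \<in> S"
    and add: "x \<in> S \<Longrightarrow> y \<in> S \<Longrightarrow> T (x + y) = T x + T y"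
    and homogeneous: "x \<in> S \<Longrightarrow> T (c *s x) = c *s T x"
begin

lemmas S_closed = subspace_0[OF subspace_S] subspace_add[OF subspace_S]
  subspace_diff[OF subspace_S] subspace_neg[OF subspace_S] subspace_scale[OF subspace_S]

lemma zero [simp]: "T 0 = 0"
  using homogeneous[of 0 0] S_closed(1) by simp

lemma uminus: "x \<in> S \<Longrightarrow> T (- x) = - T x"
  using homogeneous[of x "- 1"] by simp

lemma subspace_endo_uminus: "subspace_endo scale S (\<lambda>x. - T x)"
  by unfold_locales (simp_all add: subspace_S closed S_closed add homogeneous)

text \<open>
  The vector $p(T) x$, by Horner's scheme.
\<close>

definition poly_act :: "complex poly \<Rightarrow> 'v \<Rightarrow> 'v" where
  "poly_act p x = fold_coeffs (\<lambda>a y. a *s x + T y) p 0"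

lemma poly_act_0 [simp]: "poly_act 0 x = 0"
  by (simp add: poly_act_def)

lemma poly_act_pCons [simp]: "poly_act (pCons a p) x = a *s x + T (poly_act p x)"
  by (cases "p = 0"; cases "a = 0") (simp_all add: poly_act_def)

lemma poly_act_closed: "x \<in> S \<Longrightarrow> poly_act p x \<in> S"
  by (induction p) (simp_all add: S_closed closed)

lemma poly_act_add: "x \<in> S \<Longrightarrow> poly_act (p + q) x = poly_act p x + poly_act q x"
proof (induction p q rule: poly_induct2)
  case (pCons a p b q)
  then show ?case
    by (simp add: add poly_act_closed scale_left_distrib)
qed simp

lemma poly_act_smult: "x \<in> S \<Longrightarrow> poly_act (Polynomial.smult c p) x = c *s poly_act p x"
  by (induction p) (simp_all add: homogeneous poly_act_closed scale_right_distrib)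

lemma poly_act_diff: "x \<in> S \<Longrightarrow> poly_act (p - q) x = poly_act p x - poly_act q x"
  using poly_act_add[of x "p - q" q] by simp

lemma poly_act_add_right:
  "x \<in> S \<Longrightarrow> y \<in> S \<Longrightarrow> poly_act p (x + y) = poly_act p x + poly_act p y"
  by (induction p) (simp_all add: add poly_act_closed scale_right_distrib)

lemma poly_act_scale_right: "x \<in> S \<Longrightarrow> poly_act p (c *s x) = c *s poly_act p x"
  by (induction p) (simp_all add: homogeneous poly_act_closed scale_right_distrib mult.commute)

lemma poly_act_zero_right [simp]: "poly_act p 0 = 0"
  by (induction p) simp_all

lemma poly_act_eigenvector:
  "x \<in> S \<Longrightarrow> T x = \<mu> *s x \<Longrightarrow> poly_act p x = poly p \<mu> *s x"
  by (induction p) (simp_all add: homogeneous scale_left_distrib mult.commute)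

lemma poly_act_sum_right:
  "(\<And>i. i \<in> A \<Longrightarrow> f i \<in> S) \<Longrightarrow> poly_act p (sum f A) = (\<Sum>i\<in>A. poly_act p (f i))"
  by (induction A rule: infinite_finite_induct)
    (simp_all add: poly_act_add_right subspace_sum[OF subspace_S])

lemma subspace_poly_act_kernel: "subspace {x \<in> S. poly_act p x = 0}"
  by (rule subspaceI) (simp_all add: S_closed poly_act_add_right poly_act_scale_right)

text \<open>
  The polynomial that vanishes at all other eigenvalues isolates one summand.
\<close>

lemma eigenvectors_independent:
  assumes A: "finite A" "inj_on \<mu> A" "i \<in> A"
    and y: "\<And>j. j \<in> A \<Longrightarrow> y j \<in> S" "\<And>j. j \<in> A \<Longrightarrow> y j \<noteq> 0"
      "\<And>j. j \<in> A \<Longrightarrow> T (y j) = \<mu> j *s y j"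
    and sum0: "(\<Sum>j\<in>A. c j *s y j) = 0"
  shows "c i = 0"
proof -
  define p where "p = (\<Prod>j\<in>A - {i}. [:- \<mu> j, 1:])"
  have "poly p (\<mu> j) = 0" if "j \<in> A - {i}" for j
    using A(1) that by (auto simp: p_def poly_prod intro!: prod_zero)
  then have "(\<Sum>j\<in>A. poly_act p (c j *s y j)) =
      (\<Sum>j\<in>A. if j = i then (c i * poly p (\<mu> i)) *s y i else 0)"
    using y by (intro sum.cong) (auto simp: poly_act_scale_right poly_act_eigenvector)
  moreover have "(\<Sum>j\<in>A. poly_act p (c j *s y j)) = 0"
    using sum0 y by (simp add: S_closed flip: poly_act_sum_right)
  ultimately have "(c i * poly p (\<mu> i)) *s y i = 0"
    using A by simp
  moreover have "poly p (\<mu> i) \<noteq> 0"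
    using A by (auto simp: p_def poly_prod inj_on_def)
  ultimately show ?thesis
    using y(2)[OF A(3)] by simp
qed

text \<open>
  Otherwise the first vectors of the sequence would be linearly independent families of arbitrary
  size in a finitely generated space.
\<close>

lemma sequence_dependent:
  assumes "finite B" "span B = S" "\<And>i::nat. y i \<in> S"
  shows "\<exists>k. y k \<in> span (y ` {..<k})"
proof (rule ccontr)
  assume *: "\<nexists>k. y k \<in> span (y ` {..<k})"
  have "independent (y ` {..<k}) \<and> card (y ` {..<k}) = k" for k
  proof (induction k)
    case (Suc k)
    have k: "y k \<notin> span (y ` {..<k})"
      using * by blast
    then have "y k \<notin> y ` {..<k}"
      by (metis span_base)
    with Suc k show ?case
      by (simp add: lessThan_Suc independent_insert)
  qed (simp add: independent_empty)
  then have "independent (y ` {..<Suc (card B)})" "card (y ` {..<Suc (card B)}) = Suc (card B)"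
    by blast+
  moreover have "y ` {..<Suc (card B)} \<subseteq> span B"
    using assms(2,3) by blast
  ultimately show False
    using independent_span_bound[OF assms(1)] by fastforce
qed

text \<open>
  If $y_k$ lies in the span of its predecessors, then the polynomial with their eigenvalues as
  roots kills it, but it also acts on $y_k$ by a non-zero scalar.
\<close>

lemma infinitely_many_eigenvalues_imp_zero:
  assumes "finite B" "span B = S" "\<And>i::nat. y i \<in> S" "\<And>i. T (y i) = \<mu> i *s y i" "inj \<mu>"
  shows "\<exists>i. y i = 0"
proof -
  obtain k where k: "y k \<in> span (y ` {..<k})"
    using sequence_dependent[OF assms(1,2), of y] assms(3) by blast
  define p where "p = (\<Prod>j<k. [:- \<mu> j, 1:])"
  have "poly p (\<mu> j) = 0" if "j < k" for j
    using that by (auto simp: p_def poly_prod intro!: prod_zero)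
  then have "y ` {..<k} \<subseteq> {x \<in> S. poly_act p x = 0}"
    using assms(3) by (auto simp: poly_act_eigenvector[OF assms(3,4)])
  from span_minimal[OF this subspace_poly_act_kernel] k have "poly_act p (y k) = 0"
    by blast
  moreover have "poly p (\<mu> k) \<noteq> 0"
    using assms(5) by (auto simp: p_def poly_prod inj_def)
  ultimately show ?thesis
    using assms(3) by (auto simp: poly_act_eigenvector[OF assms(3,4)])
qed

lemma exists_annihilating_poly:
  assumes "finite B" "span B = S" "x \<in> S"
  shows "\<exists>p. p \<noteq> 0 \<and> poly_act p x = 0"
proof -
  define y where "y i = poly_act (monom 1 i) x" for i
  obtain k where k: "y k \<in> span (y ` {..<k})"
    using sequence_dependent[OF assms(1,2), of y] assms(3) by (auto simp: y_def poly_act_closed)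
  (* The span of the first k iterates consists of the values p(T) x with p of degree below k.
     Working with this set avoids any distinction whether the iterates are pairwise different. *)
  let ?R = "{poly_act p x |p. \<forall>i\<ge>k. coeff p i = 0}"
  have "subspace ?R"
  proof (rule subspaceI)
    show "0 \<in> ?R"
      by (rule CollectI, rule exI[of _ 0]) simp
    show "u + v \<in> ?R" if uv: "u \<in> ?R" "v \<in> ?R" for u v
    proof -
      from uv obtain p q where "u = poly_act p x" "v = poly_act q x"
          "\<forall>i\<ge>k. coeff p i = 0" "\<forall>i\<ge>k. coeff q i = 0"
        by blast
      then show ?thesis
        using assms(3) by (intro CollectI exI[of _ "p + q"]) (simp add: poly_act_add)
    qed
    show "c *s u \<in> ?R" if u: "u \<in> ?R" for c u
    proof -
      from u obtain p where "u = poly_act p x" "\<forall>i\<ge>k. coeff p i = 0"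
        by blast
      then show ?thesis
        using assms(3) by (intro CollectI exI[of _ "Polynomial.smult c p"])
          (simp add: poly_act_smult)
    qed
  qed
  moreover have "y ` {..<k} \<subseteq> ?R"
  proof
    fix u assume "u \<in> y ` {..<k}"
    then obtain j where "j < k" "u = y j"
      by blast
    then show "u \<in> ?R"
      by (intro CollectI exI[of _ "monom 1 j"]) (simp add: y_def)
  qed
  ultimately have "span (y ` {..<k}) \<subseteq> ?R"
    by (intro span_minimal)
  with k obtain p where p: "y k = poly_act p x" "\<forall>i\<ge>k. coeff p i = 0"
    by blast
  have "poly_act (monom 1 k - p) x = 0"
    using p(1) assms(3) by (simp add: poly_act_diff y_def)
  moreover have "coeff (monom 1 k - p) k = 1"
    using p(2) by simp
  then have "monom 1 k - p \<noteq> 0"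
    by (metis coeff_0 zero_neq_one)
  ultimately show ?thesis
    by blast
qed

text \<open>
  A polynomial $p$ of least degree with $p(T)x = 0$ has a root $\<mu>$; writing $p = (t - \<mu>) q$,
  minimality makes $q(T)x$ a non-zero eigenvector.
\<close>

lemma exists_eigenvector:
  assumes "finite B" "span B = S" "S \<noteq> {0}"
  shows "\<exists>x \<mu>. x \<in> S \<and> x \<noteq> 0 \<and> T x = \<mu> *s x"
proof -
  obtain x where x: "x \<in> S" "x \<noteq> 0"
    using assms(3) S_closed(1) by blast
  let ?P = "\<lambda>p. p \<noteq> 0 \<and> poly_act p x = 0"
  define p where "p = arg_min degree ?P"
  have ex: "\<exists>p. ?P p"
    using exists_annihilating_poly[OF assms(1,2) x(1)] .
  have p: "?P p"
    using arg_min_natI[of ?P] ex unfolding p_def by blast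
  have min: "degree p \<le> degree q" if "?P q" for q
    using arg_min_nat_le[of ?P q degree] that unfolding p_def by blast
  have "degree p \<noteq> 0"
  proof
    assume "degree p = 0"
    then obtain a where "p = [:a:]"
      by (metis degree_eq_zeroE)
    with p x show False by simp
  qed
  then have "\<not> constant (poly p)"
    by (simp add: constant_degree)
  then obtain \<mu> where "poly p \<mu> = 0"
    using fundamental_theorem_of_algebra by blast
  then obtain q where q: "p = [:- \<mu>, 1:] * q"
    by (metis poly_eq_0_iff_dvd dvdE)
  from p q have "q \<noteq> 0" by auto
  then have "degree q < degree p"
    by (simp add: q degree_mult_eq del: mult_pCons_left)
  with min[of q] \<open>q \<noteq> 0\<close> have nz: "poly_act q x \<noteq> 0"
    by fastforce
  have "0 = poly_act (pCons 0 q - Polynomial.smult \<mu> q) x"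
    using p q by simp
  also have "\<dots> = T (poly_act q x) - \<mu> *s poly_act q x"
    using x(1) by (simp only: poly_act_diff poly_act_smult poly_act_pCons) simp
  finally show ?thesis
    using nz x(1) poly_act_closed by (metis eq_iff_diff_eq_0)
qed

end


section \<open>Chains of weight vectors\<close>

locale XYZ_rep = vector_space scale + X: subspace_endo scale S X + Y: subspace_endo scale S Y
    + Z: subspace_endo scale S Z
  for scale :: "complex \<Rightarrow> 'v::ab_group_add \<Rightarrow> 'v" (infixr \<open>*s\<close> 75)
    and S :: "'v set" and X Y Z :: "'v \<Rightarrow> 'v" +
  assumes XZ: "x \<in> S \<Longrightarrow> X (Z x) + Z (X x) = 2 *s X x"
    and YZ: "x \<in> S \<Longrightarrow> Y (Z x) + Z (Y x) = (- 2) *s Y x"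
    and XX: "x \<in> S \<Longrightarrow> X (X x) = Y (Y x) + Z x"
begin

lemmas S_closed = X.S_closed X.closed Y.closed Z.closed

text \<open>
  By this symmetry, whatever holds for weight vectors killed by $Y$ also holds for those killed
  by $X$. It exchanges the families $A$ and $B$.
\<close>

lemma XYZ_rep_swap: "XYZ_rep scale S Y X (\<lambda>x. - Z x)"
proof -
  interpret minusZ: subspace_endo scale S "\<lambda>x. - Z x"
    by (rule Z.subspace_endo_uminus)
  show ?thesis
  proof
    fix x assume x: "x \<in> S"
    show "Y (- Z x) + - Z (Y x) = 2 *s Y x"
      using arg_cong[OF YZ[OF x], of uminus] x by (simp add: Y.uminus S_closed)
    show "X (- Z x) + - Z (X x) = (- 2) *s X x"
      using arg_cong[OF XZ[OF x], of uminus] x by (simp add: X.uminus S_closed)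
    show "Y (Y x) = X (X x) + - Z x"
      using XX[OF x] by simp
  qed
qed

lemma X_weight:
  assumes "x \<in> S" "Z x = \<mu> *s x"
  shows "Z (X x) = (2 - \<mu>) *s X x"
  using XZ[OF assms(1)] assms by (simp add: X.homogeneous scale_left_diff_distrib eq_diff_eq add.commute)

lemma Y_weight:
  assumes "x \<in> S" "Z x = \<mu> *s x"
  shows "Z (Y x) = (- 2 - \<mu>) *s Y x"
  using YZ[OF assms(1)] assms by (simp add: Y.homogeneous scale_left_diff_distrib eq_diff_eq add.commute)

definition step :: "nat \<Rightarrow> 'v \<Rightarrow> 'v" where
  "step i = (if even i then X else Y)"

primrec chain :: "'v \<Rightarrow> nat \<Rightarrow> 'v" where
  "chain x 0 = x"
| "chain x (Suc i) = step i (chain x i)"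

text \<open>
  The weight of the element with index \<open>i\<close> of a chain that starts in weight $\<kappa>$.
\<close>

definition weight :: "complex \<Rightarrow> nat \<Rightarrow> complex" where
  "weight \<kappa> i = (if even i then \<kappa> - 2 * of_nat i else 2 * of_nat i - \<kappa>)"

definition chain_start :: "complex \<Rightarrow> 'v \<Rightarrow> bool" where
  "chain_start \<kappa> x \<longleftrightarrow> x \<in> S \<and> x \<noteq> 0 \<and> Y x = 0 \<and> Z x = \<kappa> *s x"

sublocale step: subspace_endo scale S "step i" for i
  using X.subspace_endo_axioms Y.subspace_endo_axioms by (simp add: step_def)

lemma step_cong_even: "even i = even j \<Longrightarrow> step i = step j"
  by (simp add: step_def)

lemma chain_closed: "x \<in> S \<Longrightarrow> chain x i \<in> S"
  by (induction i) (simp_all add: step.closed)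

lemma chain_lincomb:
  "x \<in> S \<Longrightarrow> y \<in> S \<Longrightarrow> chain (a *s x + b *s y) i = a *s chain x i + b *s chain y i"
  by (induction i) (simp_all add: step.add step.homogeneous chain_closed S_closed)

lemma chain_eq_0: "chain x i = 0 \<Longrightarrow> i \<le> j \<Longrightarrow> chain x j = 0"
  by (induction j) (auto simp: le_Suc_eq)

lemma chain_weight:
  assumes "x \<in> S" "Z x = \<kappa> *s x"
  shows "Z (chain x i) = weight \<kappa> i *s chain x i"
proof (induction i)
  case 0
  then show ?case using assms by (simp add: weight_def)
next
  case (Suc i)
  have eq: "weight \<kappa> (Suc i) = (if even i then 2 - weight \<kappa> i else - 2 - weight \<kappa> i)"
    by (simp add: weight_def)
  show ?case
    using X_weight[OF chain_closed[OF assms(1)] Suc] Y_weight[OF chain_closed[OF assms(1)] Suc]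
    unfolding eq by (simp add: step_def)
qed

text \<open>
  By induction, $T_{i-1}^2 = i(\<kappa>-i+1)$ on $x_i$ (which also holds for $i = 0$, where the
  square of $Y$ vanishes), and $T_i^2$ differs from it by $\pm Z$. Hence $T_i^2$ acts on $x_i$ by
  $i(\<kappa>-i+1) + (\<kappa>-2i) = (i+1)(\<kappa>-i)$, and this is $T_i x_{i+1}$.
\<close>

lemma step_chain_Suc:
  assumes "x \<in> S" "Y x = 0" "Z x = \<kappa> *s x"
  shows "step i (chain x (Suc i)) = (of_nat (i + 1) * (\<kappa> - of_nat i)) *s chain x i"
proof (induction i)
  case 0
  then show ?case using assms by (simp add: step_def XX)
next
  case (Suc i)
  let ?y = "chain x (Suc i)"
  have y: "?y \<in> S"
    by (rule chain_closed[OF assms(1)])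
  have *: "step i (step i ?y) = (of_nat (i + 1) * (\<kappa> - of_nat i)) *s ?y"
    using Suc by (simp add: step.homogeneous chain_closed assms(1) del: of_nat_Suc)
  have "step (Suc i) (step (Suc i) ?y) =
      step i (step i ?y) + (if even i then - 1 else 1) *s Z ?y"
    using XX[OF y] by (cases "even i") (simp_all add: step_def del: chain.simps)
  also have "\<dots> = (of_nat (i + 1) * (\<kappa> - of_nat i) +
      (if even i then - 1 else 1) * weight \<kappa> (Suc i)) *s ?y"
    unfolding * chain_weight[OF assms(1,3)] scale_scale scale_left_distrib ..
  also have "of_nat (i + 1) * (\<kappa> - of_nat i) + (if even i then - 1 else 1) * weight \<kappa> (Suc i) =
      of_nat (Suc i + 1) * (\<kappa> - of_nat (Suc i))"
    by (simp add: weight_def algebra_simps)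
  finally show ?case
    by simp
qed

text \<open>
  The elements with even index have weights $\<kappa>, \<kappa>-4, \<kappa>-8, \ldots$, so they cannot all be
  non-zero. At the last non-zero element \<open>step_chain_Suc\<close> reads
  $0 = (N+1)(\<kappa>-N) x_N$.
\<close>

lemma chain_length:
  assumes B: "finite B" "span B = S" and x: "chain_start \<kappa> x"
  shows "\<exists>N. \<kappa> = of_nat N \<and> chain x N \<noteq> 0 \<and> chain x (Suc N) = 0"
proof -
  note x = x[unfolded chain_start_def]
  have "\<exists>k. chain x (2 * k) = 0"
  proof (rule Z.infinitely_many_eigenvalues_imp_zero[OF B])
    show "Z (chain x (2 * k)) = weight \<kappa> (2 * k) *s chain x (2 * k)" for k
      using x by (intro chain_weight) auto
    show "inj (\<lambda>k. weight \<kappa> (2 * k))"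
      by (rule injI) (simp add: weight_def)
  qed (use x chain_closed in auto)
  then have ex: "\<exists>i. chain x i = 0"
    by blast
  define N where "N = (LEAST i. chain x i = 0) - 1"
  have "(LEAST i. chain x i = 0) \<noteq> 0"
    using LeastI_ex[OF ex] x by (metis chain.simps(1))
  then have S: "Suc N = (LEAST i. chain x i = 0)"
    by (simp add: N_def)
  have 1: "chain x (Suc N) = 0"
    unfolding S by (rule LeastI_ex[OF ex])
  have 2: "chain x N \<noteq> 0"
    using not_less_Least[of N "\<lambda>i. chain x i = 0"] S by (metis lessI)
  have "(of_nat (N + 1) * (\<kappa> - of_nat N)) *s chain x N = 0"
    using step_chain_Suc[of x \<kappa> N] x 1 by (metis step.zero)
  then have "\<kappa> = of_nat N"
    using 2 by (simp del: of_nat_Suc)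
  with 1 2 show ?thesis
    by blast
qed

text \<open>
  Since $N$ is odd, the indices $i$ and $N - i - 1$ have the same parity. Hence the step that leads from
  $x_{N-i}$ back to a multiple of $x_{N-i-1}$ is the one that a chain uses at its index $i$. The factors
  $(j+1)(N-j)$ that arise are non-zero because only $j < N$ occurs.
\<close>

lemma reverse_chain:
  assumes x: "chain_start (of_nat N) x" and "odd N" "i \<le> N"
  shows "\<exists>c. c \<noteq> 0 \<and> chain (chain x N) i = c *s chain x (N - i)"
  using assms(3)
proof (induction i)
  case 0
  show ?case by (rule exI[of _ 1]) simp
next
  case (Suc i)
  then obtain c where c: "c \<noteq> 0" "chain (chain x N) i = c *s chain x (N - i)"
    by auto
  define j where "j = N - Suc i"
  have j: "N - i = Suc j" "even j = even i" "j < N"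
    using Suc.prems assms(2) by (auto simp: j_def)
  have "chain (chain x N) (Suc i) = c *s step j (chain x (Suc j))"
    using x j c by (simp add: step.homogeneous step_cong_even[of i j] chain_start_def
      chain_closed del: chain.simps(2))
      (simp add: step_cong_even[of i j] step.homogeneous chain_closed step.closed)
  also have "\<dots> = (c * (of_nat (j + 1) * (of_nat N - of_nat j))) *s chain x j"
    using x by (simp add: step_chain_Suc chain_start_def del: chain.simps(2) of_nat_Suc)
  finally show ?case
    using c(1) j(3) unfolding j_def[symmetric]
    by (intro exI[of _ "c * (of_nat (j + 1) * (of_nat N - of_nat j))"])
      (simp del: of_nat_Suc chain.simps(2))
qed

text \<open>
  Write $p = x_{L-1}$ and $q = x_L$. The middle step sends $p$ to $q$ and $q$ to
  $L(N-L+1) p = L^2 p$, where $N = 2L - 1$. So $Lp + sq$ with $s = \pm 1$ is an eigenvector for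
  $sL$ unless it is zero, which cannot happen for both signs as $p \neq 0$. By
  \<open>reverse_chain\<close>, it is reached from a combination of $x_0$ and $x_N$, which are both killed
  by $Y$ and of weight $N$.
\<close>

lemma folded_chain:
  assumes x: "chain_start (of_nat (2 * L - 1)) x" and L: "L > 0"
    and ne: "chain x (2 * L - 1) \<noteq> 0" and eq0: "chain x (2 * L) = 0"
  shows "\<exists>y s. (s = 1 \<or> s = - 1) \<and> chain_start (of_nat (2 * L - 1)) y \<and> chain y (L - 1) \<noteq> 0 \<and>
    step (L - 1) (chain y (L - 1)) = of_int (s * int L) *s chain y (L - 1)"
proof -
  define N where "N = 2 * L - 1"
  note x = x[folded N_def] and ne = ne[folded N_def]
  have xS: "x \<in> S" "chain x i \<in> S" for i
    using x chain_closed by (auto simp: chain_start_def)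
  have N: "odd N" "L - 1 \<le> N" "N - (L - 1) = L" "Suc N = 2 * L"
    using L by (auto simp: N_def)
  obtain c where c: "c \<noteq> 0" "chain (chain x N) (L - 1) = c *s chain x L"
    using reverse_chain[OF x N(1,2)] N(3) by auto
  let ?p = "chain x (L - 1)" and ?q = "chain x L"
  have p: "step (L - 1) ?p = ?q"
    using L by (metis Suc_diff_1 chain.simps(2))
  have "step (L - 1) ?q = (of_nat L * (of_nat N - of_nat (L - 1))) *s ?p"
    using step_chain_Suc[of x "of_nat N" "L - 1"] x L by (simp add: chain_start_def)
  then have q: "step (L - 1) ?q = (of_nat L * of_nat L) *s ?p"
    using L by (simp add: N_def of_nat_diff)
  have p_ne: "?p \<noteq> 0"
    using ne chain_eq_0 N(2) by blast
  have "\<exists>s::int. (s = 1 \<or> s = - 1) \<and> of_nat L *s ?p + of_int s *s ?q \<noteq> 0"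
  proof (rule ccontr)
    assume "\<not> ?thesis"
    then have "of_nat L *s ?p + ?q = 0" "of_nat L *s ?p - ?q = 0"
      by (metis of_int_1 scale_one, metis of_int_minus of_int_1 scale_minus_left scale_one
        diff_conv_add_uminus)
    then have "of_nat L *s ?p + of_nat L *s ?p = 0"
      by (metis eq_iff_diff_eq_0)
    then have "(of_nat L + of_nat L) *s ?p = 0"
      by (simp only: scale_left_distrib)
    then show False
      using p_ne L by (simp flip: of_nat_add)
  qed
  then obtain s :: int where s: "s = 1 \<or> s = - 1" "of_nat L *s ?p + of_int s *s ?q \<noteq> 0"
    by blast
  (* The chain from the last element has c *s ?q at index L - 1, hence the division by c. *)
  define y where "y = of_nat L *s x + (of_int s / c) *s chain x N"
  have y: "chain y (L - 1) = of_nat L *s ?p + of_int s *s ?q"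
    using c xS by (simp add: y_def chain_lincomb)
  have "y \<noteq> 0"
    using s(2) y chain_eq_0[of y 0 "L - 1"] by auto
  have "weight (of_nat N) N = of_nat N"
    using N(1) by (simp add: weight_def)
  then have "Z (chain x N) = of_nat N *s chain x N"
    using chain_weight[of x "of_nat N" N] x by (simp add: chain_start_def)
  moreover have "Y (chain x N) = 0"
    using eq0 N(1) unfolding N(4)[symmetric] by (simp add: step_def)
  ultimately have "chain_start (of_nat N) y"
    using x xS \<open>y \<noteq> 0\<close> unfolding chain_start_def y_def
    by (simp add: S_closed Y.add Y.homogeneous Z.add Z.homogeneous scale_right_distrib mult.commute)
  moreover have "step (L - 1) (chain y (L - 1)) = of_int (s * int L) *s chain y (L - 1)"
    using s(1) by (auto simp: y step.add step.homogeneous S_closed xS p q scale_right_distrib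
      add.commute simp del: One_nat_def)
  moreover have "chain y (L - 1) \<noteq> 0"
    using s(2) y by simp
  ultimately show ?thesis
    using s(1) unfolding N_def by blast
qed

text \<open>
  Iterating $XY$ on a weight vector raises its weight by $4$ each time, so it ends with a non-zero
  $v$ such that $X(Yv) = 0$. Either $Yv = 0$, or $Yv$ is killed by $X$.
\<close>

lemma exists_chain_start:
  assumes B: "finite B" "span B = S" and ne: "S \<noteq> {0}"
  shows "(\<exists>\<kappa> x. chain_start \<kappa> x) \<or> (\<exists>\<kappa> x. XYZ_rep.chain_start scale S X (\<lambda>x. - Z x) \<kappa> x)"
proof -
  interpret swap: XYZ_rep scale S Y X "\<lambda>x. - Z x"
    by (rule XYZ_rep_swap)
  obtain x \<mu> where x: "x \<in> S" "x \<noteq> 0" "Z x = \<mu> *s x"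
    using Z.exists_eigenvector[OF B ne] by blast
  define f where "f i = ((\<lambda>x. X (Y x)) ^^ i) x" for i
  have fS: "f i \<in> S" for i
    by (induction i) (simp_all add: f_def x S_closed)
  have fZ: "Z (f i) = (\<mu> + 4 * of_nat i) *s f i" for i
  proof (induction i)
    case 0
    then show ?case by (simp add: f_def x)
  next
    case (Suc i)
    have "f (Suc i) = X (Y (f i))" by (simp add: f_def)
    then show ?case
      using X_weight[OF Y.closed[OF fS] Y_weight[OF fS Suc]] by (simp add: algebra_simps)
  qed
  have "\<exists>i. f i = 0"
    by (rule Z.infinitely_many_eigenvalues_imp_zero[OF B fS fZ]) (auto intro: injI)
  moreover have "f 0 \<noteq> 0"
    using x by (simp add: f_def)
  ultimately have "\<exists>i. f i \<noteq> 0 \<and> f (Suc i) = 0"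
    using nat_induct[of "\<lambda>i. f i \<noteq> 0"] by blast
  then obtain i where i: "f i \<noteq> 0" "f (Suc i) = 0"
    by blast
  have XY0: "X (Y (f i)) = 0"
    using i(2) by (simp add: f_def)
  show ?thesis
  proof (cases "Y (f i) = 0")
    case True
    then have "chain_start (\<mu> + 4 * of_nat i) (f i)"
      using fS fZ i by (simp add: chain_start_def)
    then show ?thesis by blast
  next
    case False
    have "- Z (Y (f i)) = (2 + (\<mu> + 4 * of_nat i)) *s Y (f i)"
      unfolding Y_weight[OF fS fZ] scale_minus_left[symmetric] by simp
    then have "swap.chain_start (2 + (\<mu> + 4 * of_nat i)) (Y (f i))"
      unfolding swap.chain_start_def using False XY0 fS[of i] by (simp only: S_closed) simp
    then show ?thesis by blast
  qed
qed

lemma chain_up: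
  "even i \<Longrightarrow> X (chain x i) = chain x (Suc i)"
  "odd i \<Longrightarrow> Y (chain x i) = chain x (Suc i)"
  by (simp_all add: step_def)

text \<open>
  The coefficients in the tables are integers; with an arbitrary \<open>k\<close>, each of them
  can be matched with the product by a separate computation.
\<close>

lemma chain_down:
  assumes "chain_start (of_nat N) x" "k = int (i + 1) * (int N - int i)"
  shows "even i \<Longrightarrow> X (chain x (Suc i)) = of_int k *s chain x i"
    and "odd i \<Longrightarrow> Y (chain x (Suc i)) = of_int k *s chain x i"
proof -
  have "step i (chain x (Suc i)) = of_int k *s chain x i"
    using step_chain_Suc[of x "of_nat N" i] assms unfolding chain_start_def by simp
  then show "even i \<Longrightarrow> X (chain x (Suc i)) = of_int k *s chain x i"
    and "odd i \<Longrightarrow> Y (chain x (Suc i)) = of_int k *s chain x i"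
    by (simp_all add: step_def)
qed

lemma chain_weight_int:
  assumes "chain_start (of_nat N) x" "k = (if even i then int N - 2 * int i else 2 * int i - int N)"
  shows "Z (chain x i) = of_int k *s chain x i"
  using chain_weight[of x "of_nat N" i] assms by (auto simp: chain_start_def weight_def)

end


section \<open>Recognizing the modules given by tables\<close>

lemma U_alg_induct [case_names one gen add mult scale]:
  assumes "P 1" "\<And>g. P (U_gen g)" "\<And>a b. P a \<Longrightarrow> P b \<Longrightarrow> P (a + b)"
    "\<And>a b. P a \<Longrightarrow> P b \<Longrightarrow> P (a * b)" "\<And>c a. P a \<Longrightarrow> P (U_scale c a)"
  shows "P a"
proof -
  have word: "P (abs_U_alg (Poly_Mapping.single (Word gs) 1))" for gs
  proof (induction gs)
    case Nil
    have "Poly_Mapping.single (Word []) 1 = (1 :: free_alg)"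
      by (simp add: zero_gword_def flip: single_one)
    then show ?case
      using assms(1) by (simp add: one_U_alg_def)
  next
    case (Cons g gs)
    have "Poly_Mapping.single (Word (g # gs)) 1 =
        free_gen g * Poly_Mapping.single (Word gs) (1 :: complex)"
      by (simp add: free_gen_def mult_single plus_gword_def)
    then have "abs_U_alg (Poly_Mapping.single (Word (g # gs)) 1) =
        U_gen g * abs_U_alg (Poly_Mapping.single (Word gs) 1)"
      by (simp add: U_gen.abs_eq times_U_alg.abs_eq)
    with assms(2,4) Cons show ?case
      by simp
  qed
  have scale: "U_scale c (abs_U_alg p) = abs_U_alg (Poly_Mapping.single 0 c * p)" for c p
    by (simp add: U_scale.abs_eq)
  have "P (abs_U_alg p)" for p
  proof (induction p rule: poly_mapping_linear_induct)
    case zero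
    have "abs_U_alg 0 = U_scale 0 1"
      by (simp add: one_U_alg_def scale)
    with assms(1,5) show ?case
      by metis
  next
    case (single w c)
    obtain gs where w: "w = Word gs"
      by (cases w)
    have "abs_U_alg (Poly_Mapping.single w c) =
        U_scale c (abs_U_alg (Poly_Mapping.single w 1))"
      by (simp add: scale mult_single)
    with assms(5) word w show ?case
      by metis
  next
    case (add p q)
    then show ?case
      using assms(3)[OF add] by (simp add: plus_U_alg.abs_eq)
  qed
  then show ?thesis
    by (metis Quotient3_abs_rep Quotient3_U_alg)
qed

sublocale U_module \<subseteq> vector_space "scl M"
  by (rule vector_space)

sublocale U_module \<subseteq> rep: XYZ_rep "scl M" "carr M" "act M (U_gen GX)" "act M (U_gen GY)"
  "act M (U_gen GZ)"
proof -
  have endo: "subspace_endo (scl M) (carr M) (act M a)" for a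
    by unfold_locales (simp_all add: subspace act_closed act_add act_scale)
  interpret X: subspace_endo "scl M" "carr M" "act M (U_gen GX)" by (rule endo)
  interpret Y: subspace_endo "scl M" "carr M" "act M (U_gen GY)" by (rule endo)
  interpret Z: subspace_endo "scl M" "carr M" "act M (U_gen GZ)" by (rule endo)
  show "XYZ_rep (scl M) (carr M) (act M (U_gen GX)) (act M (U_gen GY)) (act M (U_gen GZ))"
  proof
    fix x assume x: "x \<in> carr M"
    have two: "act M (a + a) x = scl M 2 (act M a x)" for a
      using scale_left_distrib[of 1 1 "act M a x"] x by (simp add: add_act)
    have neg: "act M (- a) x = - act M a x" for a
    proof -
      have "act M 0 x = 0"
        using add_act[OF x, of 0 0] by simp
      then show ?thesis
        using add_act[OF x, of a "- a"] by (simp add: minus_unique)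
    qed
    show "act M (U_gen GX) (act M (U_gen GZ) x) + act M (U_gen GZ) (act M (U_gen GX) x) =
        scl M 2 (act M (U_gen GX) x)"
      using U_relations(1) x two[of "U_gen GX"] by (metis add_act mult_act mult_2)
    show "act M (U_gen GY) (act M (U_gen GZ) x) + act M (U_gen GZ) (act M (U_gen GY) x) =
        scl M (- 2) (act M (U_gen GY) x)"
      using U_relations(2) x two[of "U_gen GY"] neg[of "U_gen GY + U_gen GY"]
      by (metis add_act mult_act mult_2 mult_minus_left scale_minus_left)
    show "act M (U_gen GX) (act M (U_gen GX) x) =
        act M (U_gen GY) (act M (U_gen GY) x) + act M (U_gen GZ) x"
      using U_relations(3) x
      by (metis add_act mult_act power2_eq_square add.commute diff_add_cancel)
  qed
qed

sublocale U_module \<subseteq> swap: XYZ_rep "scl M" "carr M" "act M (U_gen GY)" "act M (U_gen GX)"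
  "\<lambda>x. - act M (U_gen GZ) x"
  by (rule rep.XYZ_rep_swap)

context U_module
begin

definition lincomb :: "('i \<Rightarrow> 'v) \<Rightarrow> ('i \<Rightarrow>\<^sub>0 complex) \<Rightarrow> 'v" where
  "lincomb \<phi> p = (\<Sum>i\<in>Poly_Mapping.keys p. scl M (Poly_Mapping.lookup p i) (\<phi> i))"

lemma lincomb_superset:
  assumes "finite A" "Poly_Mapping.keys p \<subseteq> A"
  shows "lincomb \<phi> p = (\<Sum>i\<in>A. scl M (Poly_Mapping.lookup p i) (\<phi> i))"
  unfolding lincomb_def
  by (rule sum.mono_neutral_left) (use assms in \<open>auto simp: in_keys_iff\<close>)

lemma lincomb_add: "lincomb \<phi> (p + q) = lincomb \<phi> p + lincomb \<phi> q"
proof -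
  define A where "A = Poly_Mapping.keys p \<union> Poly_Mapping.keys q"
  have A: "finite A" "Poly_Mapping.keys p \<subseteq> A" "Poly_Mapping.keys q \<subseteq> A"
    "Poly_Mapping.keys (p + q) \<subseteq> A"
    using keys_add[of p q] by (auto simp: A_def)
  show ?thesis
    by (simp add: lincomb_superset[OF A(1,2)] lincomb_superset[OF A(1,3)]
        lincomb_superset[OF A(1,4)] lookup_add scale_left_distrib sum.distrib)
qed

lemma lincomb_smult: "lincomb \<phi> (Defs.smult c p) = scl M c (lincomb \<phi> p)"
  using lincomb_superset[OF _ keys_smult, of p \<phi> c]
  by (simp add: lincomb_def scale_sum_right)

lemma lincomb_simps [simp]:
  "lincomb \<phi> 0 = 0"
  "lincomb \<phi> (bvec i) = \<phi> i"
  "lincomb \<phi> (k \<cdot> p) = scl M (of_int k) (lincomb \<phi> p)"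
  by (simp_all add: lincomb_smult ismult_def) (simp_all add: lincomb_def bvec_def)

lemma lincomb_vec_v [simp]: "lincomb \<phi> (vec_v k) = \<phi> (V k)"
  by (simp add: vec_v_def)

lemma lincomb_sum: "lincomb \<phi> (sum f A) = (\<Sum>i\<in>A. lincomb \<phi> (f i))"
  by (induction A rule: infinite_finite_induct) (simp_all add: lincomb_add)

lemma lincomb_linext: "lincomb \<phi> (linext F p) = lincomb (\<lambda>i. lincomb \<phi> (F i)) p"
  unfolding linext_def by (simp add: lincomb_sum lincomb_smult) (simp add: lincomb_def)

lemma lincomb_cong:
  "(\<And>i. i \<in> Poly_Mapping.keys p \<Longrightarrow> \<phi> i = \<psi> i) \<Longrightarrow> lincomb \<phi> p = lincomb \<psi> p"
  by (simp add: lincomb_def)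

lemma lincomb_closed:
  "(\<And>i. i \<in> Poly_Mapping.keys p \<Longrightarrow> \<phi> i \<in> carr M) \<Longrightarrow> lincomb \<phi> p \<in> carr M"
  unfolding lincomb_def by (intro subspace_sum[OF subspace] subspace_scale[OF subspace])

lemma act_zero: "act M a 0 = 0"
  using act_scale[of 0 a 0] subspace_0[OF subspace] by simp

lemma act_sum:
  "(\<And>i. i \<in> A \<Longrightarrow> f i \<in> carr M) \<Longrightarrow> act M a (sum f A) = (\<Sum>i\<in>A. act M a (f i))"
  by (induction A rule: infinite_finite_induct)
    (simp_all add: act_add act_zero subspace_sum[OF subspace])

lemma act_lincomb:
  assumes "\<And>i. i \<in> Poly_Mapping.keys p \<Longrightarrow> \<phi> i \<in> carr M"
  shows "act M a (lincomb \<phi> p) = lincomb (\<lambda>i. act M a (\<phi> i)) p"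
  using assms unfolding lincomb_def
  by (simp add: act_sum act_scale subspace_scale[OF subspace])

text \<open>
  It suffices to compare the actions of the generators on a basis of weight vectors: the linear extension of
  \<open>\<phi>\<close> is then a homomorphism, injective since the weights are pairwise different, and
  its image is a non-zero submodule of a simple module. The isomorphism asked for is its inverse.
\<close>

lemma isomorphic_table_mod:
  fixes I :: "'b set"
  assumes simple: "simple_U_module M" and tab: "U_table I T" and I: "I \<noteq> {}"
    and \<phi>: "\<And>i. i \<in> I \<Longrightarrow> \<phi> i \<in> carr M" "\<And>i. i \<in> I \<Longrightarrow> \<phi> i \<noteq> 0"
    and gen: "\<And>i g. i \<in> I \<Longrightarrow> act M (U_gen g) (\<phi> i) = lincomb \<phi> (T g i)"
    and weight: "\<And>i. i \<in> I \<Longrightarrow> T GZ i = \<mu> i \<cdot> bvec i" "inj_on \<mu> I"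
  shows "M \<cong>\<^sub>U table_mod I T"
proof -
  let ?N = "table_mod I T" and ?f = "lincomb \<phi>"
  interpret tab: U_table I T by (rule tab)
  interpret N: U_module ?N by (rule tab.table_module)
  have carr: "x \<in> carr ?N \<longleftrightarrow> Poly_Mapping.keys x \<subseteq> I" for x
    by (simp add: table_mod_def)
  have scl: "scl ?N = Defs.smult"
    by (simp add: table_mod_def)
  have f_closed: "?f x \<in> carr M" if "x \<in> carr ?N" for x
    using that by (intro lincomb_closed) (auto simp: carr \<phi>)
  have hom: "?f (act ?N a x) = act M a (?f x)" if "x \<in> carr ?N" for a x
    using that
  proof (induction a arbitrary: x rule: U_alg_induct)
    case one
    then show ?case by (simp add: N.one_act one_act f_closed)
  next
    case (gen g)
    have "?f (act ?N (U_gen g) x) = lincomb (\<lambda>i. ?f (T g i)) x"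
      using gen by (simp add: carr tab.act_gen_table_mod lincomb_linext)
    also have "\<dots> = lincomb (\<lambda>i. act M (U_gen g) (\<phi> i)) x"
      using gen assms(6) by (intro lincomb_cong) (auto simp: carr)
    also have "\<dots> = act M (U_gen g) (?f x)"
      using gen by (intro act_lincomb[symmetric]) (auto simp: carr \<phi>)
    finally show ?case .
  next
    case (add a b)
    then show ?case by (simp add: N.add_act add_act f_closed lincomb_add)
  next
    case (mult a b)
    then show ?case by (simp add: N.mult_act mult_act f_closed N.act_closed)
  next
    case (scale c a)
    then show ?case by (simp add: N.scale_act scale_act f_closed scl lincomb_smult)
  qed
  have kernel: "x = 0" if x: "x \<in> carr ?N" "?f x = 0" for x
  proof (rule poly_mapping_eqI, rule ccontr)
    fix i assume i: "Poly_Mapping.lookup x i \<noteq> Poly_Mapping.lookup 0 i"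
    have sub: "Poly_Mapping.keys x \<subseteq> I"
      using x(1) by (simp add: carr)
    have "Poly_Mapping.lookup x i = 0"
    proof (rule rep.Z.eigenvectors_independent[of "Poly_Mapping.keys x" "\<lambda>i. of_int (\<mu> i)" i \<phi>])
      show "inj_on (\<lambda>i. of_int (\<mu> i) :: complex) (Poly_Mapping.keys x)"
        using inj_on_subset[OF weight(2) sub] by (simp add: inj_on_def)
      show "act M (U_gen GZ) (\<phi> j) = scl M (of_int (\<mu> j)) (\<phi> j)"
        if "j \<in> Poly_Mapping.keys x" for j
        using that sub gen[of j GZ] weight(1)[of j] by auto
    qed (use i x(2) sub \<phi> in \<open>auto simp: in_keys_iff lincomb_def\<close>)
    with i show False by simp
  qed
  have "inj_on ?f (carr ?N)"
  proof (rule inj_onI)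
    fix x y assume xy: "x \<in> carr ?N" "y \<in> carr ?N" "?f x = ?f y"
    have "?f (x - y) = 0"
      using lincomb_add[of \<phi> "x - y" y] xy(3) by simp
    with kernel[of "x - y"] xy N.subspace_diff[OF N.subspace] show "x = y"
      by simp
  qed
  moreover have "?f ` carr ?N = carr M"
  proof -
    have "U_submodule (?f ` carr ?N) M"
      unfolding U_submodule_def
    proof (intro conjI allI ballI)
      show "?f ` carr ?N \<subseteq> carr M"
        using f_closed by blast
      show "module.subspace (scl M) (?f ` carr ?N)"
      proof (rule subspaceI)
        show "0 \<in> ?f ` carr ?N"
          by (rule image_eqI[of _ _ 0]) (simp_all add: N.subspace_0[OF N.subspace])
        show "x + y \<in> ?f ` carr ?N" if "x \<in> ?f ` carr ?N" "y \<in> ?f ` carr ?N" for x y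
          using that by (auto simp flip: lincomb_add intro!: imageI N.subspace_add[OF N.subspace])
        show "scl M c x \<in> ?f ` carr ?N" if "x \<in> ?f ` carr ?N" for c x
          using that N.subspace_scale[OF N.subspace, of _ c]
          by (auto simp: scl simp flip: lincomb_smult)
      qed
      show "act M a x \<in> ?f ` carr ?N" if "x \<in> ?f ` carr ?N" for a x
        using that by (auto simp flip: hom intro!: imageI N.act_closed)
    qed
    moreover obtain i where i: "i \<in> I"
      using I by blast
    have "\<phi> i \<in> ?f ` carr ?N"
      using i by (intro image_eqI[of _ _ "bvec i"]) (simp_all only: carr lincomb_simps, simp add: bvec_def)
    with \<phi>(2)[OF i] have "?f ` carr ?N \<noteq> {0}"
      by blast
    ultimately show ?thesis
      using simple unfolding simple_U_module_def by blast
  qed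
  ultimately have bij: "bij_betw ?f (carr ?N) (carr M)"
    by (simp add: bij_betw_def)
  define h where "h = inv_into (carr ?N) ?f"
  have h_bij: "bij_betw h (carr M) (carr ?N)"
    unfolding h_def by (rule bij_betw_inv_into[OF bij])
  have hf: "h (?f x) = x" if "x \<in> carr ?N" for x
    unfolding h_def using bij that by (rule bij_betw_inv_into_left)
  have surj: "\<exists>x\<in>carr ?N. y = ?f x" if "y \<in> carr M" for y
    using bij that unfolding bij_betw_def by blast
  show ?thesis
    unfolding U_isomorphic_def
  proof (rule exI[of _ h], intro conjI ballI allI h_bij)
    fix y assume "y \<in> carr M"
    then obtain x where x: "x \<in> carr ?N" "y = ?f x"
      using surj by blast
    show "h (scl M c y) = scl ?N c (h y)" for c
      using x hf N.subspace_scale[OF N.subspace x(1), of c]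
      by (simp add: scl flip: lincomb_smult)
    show "h (act M a y) = act ?N a (h y)" for a
      using x hf N.act_closed[OF x(1), of a] by (simp flip: hom)
    fix z assume "z \<in> carr M"
    then obtain w where w: "w \<in> carr ?N" "z = ?f w"
      using surj by blast
    show "h (y + z) = h y + h z"
      using x w hf N.subspace_add[OF N.subspace x(1) w(1)] by (simp flip: lincomb_add)
  qed
qed

text \<open>
  The basis vectors $v_k$ and $w_k$ correspond to the chain elements $x_{2k}$ and $x_{2k+1}$.
\<close>

lemma isomorphic_E_mod:
  assumes simple: "simple_U_module M" and x: "rep.chain_start (of_nat (2 * n)) x"
    and ne: "rep.chain x (2 * n) \<noteq> 0" and eq0: "rep.chain x (Suc (2 * n)) = 0"
  shows "M \<cong>\<^sub>U E_mod n"
  unfolding E_mod_def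
proof (rule isomorphic_table_mod[OF simple E_table])
  let ?c = "rep.chain x"
  let ?I = "V ` {..n} \<union> W ` {..<n}"
  define \<phi> where "\<phi> i = (case i of V k \<Rightarrow> ?c (2 * k) | W k \<Rightarrow> ?c (Suc (2 * k)) | Uu \<Rightarrow> 0)" for i
  define \<mu> where "\<mu> i = (case i of V k \<Rightarrow> 2 * int n - 4 * int k
    | W k \<Rightarrow> 4 * int k + 2 - 2 * int n | Uu \<Rightarrow> 0)" for i
  have \<phi>_simps [simp]: "\<phi> (V k) = ?c (2 * k)" "\<phi> (W k) = ?c (Suc (2 * k))" for k
    by (simp_all add: \<phi>_def)
  have w: "lincomb \<phi> (E_w n (int k)) = ?c (Suc (2 * k))" if "k \<le> n" for k
    using that eq0 by (cases "k = n") (simp_all add: E_w_def del: rep.chain.simps)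
  show "?I \<noteq> {}" by blast
  show "\<phi> i \<in> carr M" if "i \<in> ?I" for i
    using that x by (auto simp: rep.chain_closed rep.chain_start_def simp del: rep.chain.simps)
  show "\<phi> i \<noteq> 0" if "i \<in> ?I" for i
  proof -
    have "?c j \<noteq> 0" if "j \<le> 2 * n" for j
      using ne rep.chain_eq_0[of x j "2 * n"] that by blast
    with that show ?thesis by (auto simp del: rep.chain.simps)
  qed
  show "tables (E_X n) (E_Y n) (E_Z n) GZ i = \<mu> i \<cdot> bvec i" if "i \<in> ?I" for i
    using that by (auto simp: \<mu>_def vec_v_def E_w_def)
  show "inj_on \<mu> ?I"
    by (auto simp: inj_on_def \<mu>_def) presburger+
  show "act M (U_gen g) (\<phi> i) = lincomb \<phi> (tables (E_X n) (E_Y n) (E_Z n) g i)"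
    if i: "i \<in> ?I" for i g
  proof (cases g)
    case GX
    from i consider k where "i = V k" "k \<le> n" | k where "i = W k" "k < n" by auto
    then show ?thesis
    proof cases
      case (1 k)
      then show ?thesis
        by (simp add: GX w rep.chain_up del: rep.chain.simps)
    next
      case (2 k)
      have "2 * int n + int k * (4 * int n - 2 - 4 * int k) =
          int (2 * k + 1) * (int (2 * n) - int (2 * k))"
        by (simp add: algebra_simps)
      from rep.chain_down(1)[OF x this] 2 show ?thesis
        by (simp add: GX del: rep.chain.simps)
    qed
  next
    case GY
    from i consider "i = V 0" | k where "i = V (Suc k)" "k < n" | k where "i = W k" "k < n"
    proof -
      from i consider k where "i = V k" "k \<le> n" | k where "i = W k" "k < n" by auto
      then show ?thesis
      proof cases
        case (1 k)
        then show ?thesis using that(1,2) by (cases k) auto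
      qed (rule that(3))
    qed
    then show ?thesis
    proof cases
      case 1
      then show ?thesis
        using x by (simp add: GY rep.chain_start_def)
    next
      case (2 k)
      have "int (Suc k) * (4 * int n + 2 - 4 * int (Suc k)) =
          int (Suc (2 * k) + 1) * (int (2 * n) - int (Suc (2 * k)))"
        by (simp add: algebra_simps)
      from rep.chain_down(2)[OF x this] 2 show ?thesis
        using w[of k] by (simp add: GY del: rep.chain.simps of_int_mult)
    next
      case (3 k)
      then show ?thesis
        by (simp add: GY rep.chain_up del: rep.chain.simps)
    qed
  next
    case GZ
    from i consider k where "i = V k" "k \<le> n" | k where "i = W k" "k < n" by auto
    then show ?thesis
    proof cases
      case (1 k)
      then show ?thesis
        using rep.chain_weight_int[OF x, of "2 * int n - 4 * int k" "2 * k"]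
        by (simp add: GZ del: rep.chain.simps)
    next
      case (2 k)
      then show ?thesis
        using rep.chain_weight_int[OF x, of "4 * int k + 2 - 2 * int n" "Suc (2 * k)"] w[of k]
        by (simp add: GZ del: rep.chain.simps)
    qed
  qed
qed

text \<open>
  The chain $y_0, \ldots, y_{n-1}$ is $v_0, w_0, v_1, w_1, \ldots$ as long as the index permits. As
  $w_k = v_{n-1-k}$, the vector $v_k$ is $y_{2k}$ in the lower half of its range and $y_{2(n-1-k)+1}$ in
  the upper half. The step after $y_{n-1}$ is the one with the sign.
\<close>

lemma isomorphic_A_mod:
  assumes simple: "simple_U_module M" and n: "n \<ge> 1" and s: "s = 1 \<or> s = -1"
    and y: "rep.chain_start (of_nat (2 * n - 1)) y" and ne: "rep.chain y (n - 1) \<noteq> 0"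
    and fold: "rep.step (n - 1) (rep.chain y (n - 1)) =
      scl M (of_int (s * int n)) (rep.chain y (n - 1))"
  shows "M \<cong>\<^sub>U A_mod n s"
  unfolding A_mod_def
proof (rule isomorphic_table_mod[OF simple A_table[OF s]])
  let ?c = "rep.chain y"
  define \<phi> where "\<phi> i = (case i of V k \<Rightarrow> if 2 * k < n then ?c (2 * k) else ?c (2 * n - 2 * k - 1)
    | W k \<Rightarrow> 0 | Uu \<Rightarrow> 0)" for i
  define \<mu> where "\<mu> i = (case i of V k \<Rightarrow> 2 * int n - 1 - 4 * int k | W k \<Rightarrow> 0 | Uu \<Rightarrow> 0)" for i
  have \<phi>1: "\<phi> (V k) = ?c i" if "i = 2 * k" "2 * k < n" for i k
    using that by (simp add: \<phi>_def)
  have \<phi>2: "\<phi> (V k) = ?c i" if "i = 2 * n - 2 * k - 1" "n \<le> 2 * k" for i k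
    using that by (simp add: \<phi>_def)
  show "V ` {..<n} \<noteq> {}" using n by (auto simp: lessThan_empty_iff)
  show "\<phi> i \<in> carr M" if "i \<in> V ` {..<n}" for i
    using that y by (auto simp: \<phi>_def rep.chain_closed rep.chain_start_def)
  show "\<phi> i \<noteq> 0" if "i \<in> V ` {..<n}" for i
  proof -
    have "?c j \<noteq> 0" if "j < n" for j
      using ne rep.chain_eq_0[of y j "n - 1"] that by fastforce
    moreover from that obtain k where "i = V k" "k < n" by blast
    ultimately show ?thesis by (simp add: \<phi>_def)
  qed
  show "tables (A_X n s) (A_Y n s) (A_Z n) GZ i = \<mu> i \<cdot> bvec i" if "i \<in> V ` {..<n}" for i
    using that by (auto simp: \<mu>_def vec_v_def)
  show "inj_on \<mu> (V ` {..<n})"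
    by (auto simp: inj_on_def \<mu>_def) 
  show "act M (U_gen g) (\<phi> i) = lincomb \<phi> (tables (A_X n s) (A_Y n s) (A_Z n) g i)"
    if "i \<in> V ` {..<n}" for i g
  proof -
    from that obtain k where i: "i = V k" "k < n" by blast
    show ?thesis
    proof (cases g)
      case GX
      consider "2 * k + 1 < n" | "2 * k + 1 = n" | "n \<le> 2 * k" by linarith
      then show ?thesis
      proof cases
        case 1
        have "\<phi> (V k) = ?c (2 * k)"
          by (rule \<phi>1) (use 1 in \<open>auto\<close>)
        moreover have "\<phi> (V (n - 1 - k)) = ?c (Suc (2 * k))"
          by (rule \<phi>2) (use 1 in \<open>auto\<close>)
        ultimately show ?thesis using 1 i
          by (simp add: GX A_X_V rep.chain_up del: A_X.simps rep.chain.simps)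
      next
        case 2
        have "\<phi> (V k) = ?c (n - 1)"
          using 2 by (auto intro!: \<phi>1)
        moreover have "even (n - 1)"
          using 2 by presburger
        ultimately show ?thesis
          using fold 2 i by (simp add: GX A_X_V rep.step_def del: A_X.simps One_nat_def)
      next
        case 3
        define j where "j = 2 * (n - 1 - k)"
        have "\<phi> (V k) = ?c (Suc j)"
          by (rule \<phi>2) (use 3 i in \<open>auto simp: j_def\<close>)
        moreover have "\<phi> (V (n - 1 - k)) = ?c j"
          by (rule \<phi>1) (use 3 i in \<open>auto simp: j_def\<close>)
        moreover have "2 * int n - 1 + 4 * (int n - 1 - int k) * int k =
            int (j + 1) * (int (2 * n - 1) - int j)"
          using i by (simp add: j_def of_nat_diff algebra_simps)
        from rep.chain_down(1)[OF y this] have "act M (U_gen GX) (?c (Suc j)) =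
            scl M (of_int (2 * int n - 1 + 4 * (int n - 1 - int k) * int k)) (?c j)"
          by (simp add: j_def)
        ultimately show ?thesis
          using 3 i by (simp add: GX A_X_V del: A_X.simps rep.chain.simps One_nat_def)
      qed
    next
      case GY
      consider "k = 0" | "k > 0" "2 * k < n" | "k > 0" "2 * k = n" | "n < 2 * k" by linarith
      then show ?thesis
      proof cases
        case 1
        then show ?thesis
          using i y n by (simp add: GY \<phi>1 A_Y_V rep.chain_start_def del: A_Y.simps)
      next
        case 2
        define j where "j = 2 * k - 1"
        have "\<phi> (V k) = ?c (Suc j)"
          by (rule \<phi>1) (use 2 i in \<open>auto simp: j_def\<close>)
        moreover have "\<phi> (V (n - k)) = ?c j"
          by (rule \<phi>2) (use 2 i in \<open>auto simp: j_def\<close>)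
        moreover have "4 * int k * (int n - int k) =
            int (j + 1) * (int (2 * n - 1) - int j)"
          using 2 i by (simp add: j_def of_nat_diff algebra_simps)
        from rep.chain_down(2)[OF y this] have "act M (U_gen GY) (?c (Suc j)) =
            scl M (of_int (4 * int k * (int n - int k))) (?c j)"
          using 2 by (simp add: j_def)
        ultimately show ?thesis
          using 2 i by (simp add: GY A_Y_V del: A_Y.simps rep.chain.simps One_nat_def)
      next
        case 3
        have "\<phi> (V k) = ?c (n - 1)"
          using 3 by (auto intro!: \<phi>2)
        moreover have "odd (n - 1)"
          using 3 by presburger
        ultimately show ?thesis
          using fold 3 i by (simp add: GY A_Y_V rep.step_def del: A_Y.simps One_nat_def)
      next
        case 4
        define j where "j = 2 * n - 2 * k - 1"
        have "\<phi> (V k) = ?c j"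
          by (rule \<phi>2) (use 4 i in \<open>auto simp: j_def\<close>)
        moreover have "\<phi> (V (n - k)) = ?c (Suc j)"
          by (rule \<phi>1) (use 4 i in \<open>auto simp: j_def\<close>)
        moreover have "odd j"
          using 4 i by (simp add: j_def)
        ultimately show ?thesis
          using 4 i by (simp add: GY A_Y_V rep.chain_up del: A_Y.simps rep.chain.simps)
      qed
    next
      case GZ
      show ?thesis
      proof (cases "2 * k < n")
        case True
        then show ?thesis
          using rep.chain_weight_int[OF y, of "2 * int n - 1 - 4 * int k" "2 * k"] i n
          by (simp add: GZ \<phi>1 of_nat_diff)
      next
        case False
        then show ?thesis
          using rep.chain_weight_int[OF y, of "2 * int n - 1 - 4 * int k" "2 * n - 2 * k - 1"] i n
          by (simp add: GZ \<phi>2 of_nat_diff)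
      qed
    qed
  qed
qed

text \<open>
  For the exchanged generators the chain $y_0, \ldots, y_n$ is $u, v_0, w_0, v_1, w_1, \ldots$. As
  $w_k = v_{n-1-k}$, the vector $v_k$ is $y_{2k+1}$ in the lower half of its range and $y_{2(n-1-k)+2}$ in
  the upper half. There are $n + 1$ elements, so the eigenvalue at the end is $\pm(n+1)$.
\<close>

lemma isomorphic_B_mod:
  assumes simple: "simple_U_module M" and s: "s = 1 \<or> s = -1"
    and y: "swap.chain_start (of_nat (2 * n + 1)) y" and ne: "swap.chain y n \<noteq> 0"
    and fold: "swap.step n (swap.chain y n) = scl M (of_int (s * int (n + 1))) (swap.chain y n)"
  shows "M \<cong>\<^sub>U B_mod n s"
  unfolding B_mod_def
proof (rule isomorphic_table_mod[OF simple B_table[OF s]])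
  let ?c = "swap.chain y" and ?I = "insert Uu (V ` {..<n})"
  define \<phi> where "\<phi> i = (case i of
      V k \<Rightarrow> if 2 * k < n then ?c (Suc (2 * k)) else ?c (2 * n - 2 * k)
    | W k \<Rightarrow> 0 | Uu \<Rightarrow> ?c 0)" for i
  define \<mu> where "\<mu> i = (case i of V k \<Rightarrow> 2 * int n - 1 - 4 * int k | W k \<Rightarrow> 0
    | Uu \<Rightarrow> - 2 * int n - 1)" for i
  have \<phi>0: "\<phi> Uu = ?c 0"
    by (simp add: \<phi>_def)
  have \<phi>1: "\<phi> (V k) = ?c i" if "i = Suc (2 * k)" "2 * k < n" for i k
    using that by (simp add: \<phi>_def)
  have \<phi>2: "\<phi> (V k) = ?c i" if "i = 2 * n - 2 * k" "n \<le> 2 * k" for i k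
    using that by (simp add: \<phi>_def)
  have Z: "act M (U_gen GZ) (?c j) = scl M (of_int k) (?c j)"
    if "k = (if even j then 2 * int j - int (2 * n + 1) else int (2 * n + 1) - 2 * int j)" for j k
  proof -
    have "- act M (U_gen GZ) (?c j) = scl M (of_int (- k)) (?c j)"
      by (rule swap.chain_weight_int[OF y]) (use that in auto)
    then show ?thesis by simp
  qed
  show "?I \<noteq> {}" by simp
  show "\<phi> i \<in> carr M" if "i \<in> ?I" for i
    using that swap.chain_closed[of y] y
    by (auto simp: \<phi>_def swap.chain_start_def simp del: swap.chain.simps)
  show "\<phi> i \<noteq> 0" if "i \<in> ?I" for i
  proof -
    have "?c j \<noteq> 0" if "j \<le> n" for j
      using ne swap.chain_eq_0[of y j n] that by blast
    with that show ?thesis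
      by (auto simp: \<phi>_def simp del: swap.chain.simps split: if_splits)
  qed
  show "tables (B_X n s) (B_Y n s) (B_Z n) GZ i = \<mu> i \<cdot> bvec i" if "i \<in> ?I" for i
    using that by (auto simp: \<mu>_def vec_v_def)
  show "inj_on \<mu> ?I"
    by (auto simp: inj_on_def \<mu>_def)
  show "act M (U_gen g) (\<phi> i) = lincomb \<phi> (tables (B_X n s) (B_Y n s) (B_Z n) g i)"
    if "i \<in> ?I" for i g
  proof -
    from that consider "i = Uu" | k where "i = V k" "k < n" by blast
    then show ?thesis
    proof cases
      case Uu: 1
      show ?thesis
      proof (cases g)
        case GX
        then show ?thesis
          using Uu y by (simp add: \<phi>0 swap.chain_start_def)
      next
        case GY
        show ?thesis
        proof (cases "n = 0")
          case True
          then show ?thesis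
            using Uu fold by (simp add: GY \<phi>0 swap.step_def)
        next
          case False
          then have "\<phi> (V 0) = ?c (Suc 0)"
            by (intro \<phi>1) auto
          then show ?thesis
            using Uu False swap.chain_up(1)[of 0 y] by (simp add: GY \<phi>0 del: swap.chain.simps)
        qed
      next
        case GZ
        then show ?thesis
          using Uu Z[of "- 2 * int n - 1" 0] by (simp add: \<phi>0)
      qed
    next
      case i: (2 k)
      show ?thesis
      proof (cases g)
        case GX
        consider "2 * k + 1 < n" | "2 * k + 1 = n" | "n \<le> 2 * k" by linarith
        then show ?thesis
        proof cases
          case 1
          have "\<phi> (V k) = ?c (Suc (2 * k))"
            by (rule \<phi>1) (use 1 in auto)
          moreover have "\<phi> (V (n - 1 - k)) = ?c (Suc (Suc (2 * k)))"
            by (rule \<phi>2) (use 1 in auto)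
          ultimately show ?thesis
            using 1 i by (simp add: GX B_X_V swap.chain_up del: B_X.simps(1) swap.chain.simps)
        next
          case 2
          have "\<phi> (V k) = ?c n"
            by (rule \<phi>1) (use 2 in auto)
          moreover have "odd n"
            using 2 by presburger
          ultimately show ?thesis
            using fold 2 i by (simp add: GX B_X_V swap.step_def add.commute del: B_X.simps(1))
        next
          case 3
          define j where "j = 2 * n - 2 * k - 1"
          have "\<phi> (V k) = ?c (Suc j)"
            by (rule \<phi>2) (use 3 i in \<open>auto simp: j_def\<close>)
          moreover have "\<phi> (V (n - 1 - k)) = ?c j"
            by (rule \<phi>1) (use 3 i in \<open>auto simp: j_def\<close>)
          moreover have "4 * int n + 4 * (int n - 1 - int k) * int k =
              int (j + 1) * (int (2 * n + 1) - int j)"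
            using i by (simp add: j_def of_nat_diff algebra_simps)
          from swap.chain_down(2)[OF y this] have "act M (U_gen GX) (?c (Suc j)) =
              scl M (of_int (4 * int n + 4 * (int n - 1 - int k) * int k)) (?c j)"
            using i by (simp add: j_def)
          ultimately show ?thesis
            using 3 i by (simp add: GX B_X_V del: B_X.simps(1) swap.chain.simps One_nat_def)
        qed
      next
        case GY
        consider "k = 0" | "k > 0" "2 * k < n" | "k > 0" "2 * k = n" | "k > 0" "n < 2 * k"
          by linarith
        then show ?thesis
        proof cases
          case 1
          have "\<phi> (V k) = ?c (Suc 0)"
            by (rule \<phi>1) (use 1 i in auto)
          then show ?thesis
            using 1 i swap.chain_down(1)[OF y, of "2 * int n + 1" 0]
            by (simp add: GY B_Y_V \<phi>0 del: B_Y.simps(1) swap.chain.simps(2))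
        next
          case 2
          have "\<phi> (V k) = ?c (Suc (2 * k))"
            by (rule \<phi>1) (use 2 in auto)
          moreover have "\<phi> (V (n - k)) = ?c (2 * k)"
            by (rule \<phi>2) (use 2 in auto)
          moreover have "2 * int n + 1 + 4 * int k * (int n - int k) =
              int (2 * k + 1) * (int (2 * n + 1) - int (2 * k))"
            by (simp add: algebra_simps)
          from swap.chain_down(1)[OF y this] have "act M (U_gen GY) (?c (Suc (2 * k))) =
              scl M (of_int (2 * int n + 1 + 4 * int k * (int n - int k))) (?c (2 * k))"
            by simp
          ultimately show ?thesis
            using 2 i by (simp add: GY B_Y_V del: B_Y.simps(1) swap.chain.simps)
        next
          case 3
          have "\<phi> (V k) = ?c n"
            by (rule \<phi>2) (use 3 in auto)
          moreover have "even n"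
            using 3 by presburger
          ultimately show ?thesis
            using fold 3 i by (simp add: GY B_Y_V swap.step_def add.commute del: B_Y.simps(1))
        next
          case 4
          define j where "j = 2 * n - 2 * k"
          have "\<phi> (V k) = ?c j"
            by (rule \<phi>2) (use 4 i in \<open>auto simp: j_def\<close>)
          moreover have "\<phi> (V (n - k)) = ?c (Suc j)"
            by (rule \<phi>1) (use 4 i in \<open>auto simp: j_def\<close>)
          moreover have "even j"
            by (simp add: j_def)
          ultimately show ?thesis
            using 4 i by (simp add: GY B_Y_V swap.chain_up del: B_Y.simps(1) swap.chain.simps)
        qed
      next
        case GZ
        show ?thesis
        proof (cases "2 * k < n")
          case True
          then show ?thesis
            using Z[of "2 * int n - 1 - 4 * int k" "Suc (2 * k)"] i
            by (simp add: GZ \<phi>1 del: swap.chain.simps)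
        next
          case False
          then show ?thesis
            using Z[of "2 * int n - 1 - 4 * int k" "2 * n - 2 * k"] i
            by (simp add: GZ \<phi>2 of_nat_diff)
        qed
      qed
    qed
  qed
qed

end


section \<open>The classification\<close>

theorem theorem5p3:
  fixes M :: "'v::ab_group_add U_mod"
  assumes "U_module M"
    and "finite_dim_U_module M"
    and "simple_U_module M"
  shows "(\<exists>n. M \<cong>\<^sub>U E_mod n) \<or>
    (\<exists>n\<ge>1. M \<cong>\<^sub>U A_mod n 1 \<or> M \<cong>\<^sub>U A_mod n (-1)) \<or>
    (\<exists>n. M \<cong>\<^sub>U B_mod n 1 \<or> M \<cong>\<^sub>U B_mod n (-1))"
proof -
  interpret U_module M by (rule assms(1))
  note simple = assms(3)
  obtain B where B: "finite B" "span B = carr M"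
    using assms(2) unfolding finite_dim_U_module_def by blast
  have ne: "carr M \<noteq> {0}"
    using simple by (simp add: simple_U_module_def)
  consider (Y) \<kappa> x where "rep.chain_start \<kappa> x"
    | (X) \<kappa> x where "swap.chain_start \<kappa> x" "\<nexists>\<kappa> x. rep.chain_start \<kappa> x"
    using rep.exists_chain_start[OF B ne] by blast
  then show ?thesis
  proof cases
    case Y
    then obtain N where N: "rep.chain_start (of_nat N) x" "rep.chain x N \<noteq> 0" "rep.chain x (Suc N) = 0"
      using rep.chain_length[OF B] by blast
    show ?thesis
    proof (cases "even N")
      case True
      then obtain n where "N = 2 * n" by (elim evenE)
      with N show ?thesis
        using isomorphic_E_mod[OF simple, of n x] by blast
    next
      case False
      define n where "n = (N + 1) div 2"
      have n: "N = 2 * n - 1" "Suc N = 2 * n" "n \<ge> 1"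
        using False by (auto simp: n_def elim!: oddE)
      obtain y s where "s = 1 \<or> s = - 1" "rep.chain_start (of_nat (2 * n - 1)) y"
        "rep.chain y (n - 1) \<noteq> 0" "rep.step (n - 1) (rep.chain y (n - 1)) =
          scl M (of_int (s * int n)) (rep.chain y (n - 1))"
        using rep.folded_chain[of n x] N n by (metis less_eq_Suc_le One_nat_def)
      then show ?thesis
        using isomorphic_A_mod[OF simple n(3)] n(3) by blast
    qed
  next
    case X
    then obtain N where N: "swap.chain_start (of_nat N) x" "swap.chain x N \<noteq> 0"
        "swap.chain x (Suc N) = 0"
      using swap.chain_length[OF B] by blast
    (* A chain of odd length would end in a vector killed by Y, which is the other case. *)
    have "odd N"
    proof
      assume "even N"
      then have "act M (U_gen GY) (swap.chain x N) = 0"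
        using N(3) by (simp add: swap.step_def)
      moreover have "- act M (U_gen GZ) (swap.chain x N) =
          scl M (swap.weight (of_nat N) N) (swap.chain x N)"
        using swap.chain_weight[of x "of_nat N" N] N(1) by (simp add: swap.chain_start_def)
      then have "act M (U_gen GZ) (swap.chain x N) =
          scl M (- swap.weight (of_nat N) N) (swap.chain x N)"
        by (metis minus_minus scale_minus_left)
      moreover have "swap.chain x N \<in> carr M"
        using swap.chain_closed N(1) by (simp add: swap.chain_start_def)
      ultimately have "rep.chain_start (- swap.weight (of_nat N) N) (swap.chain x N)"
        using N(2) by (simp add: rep.chain_start_def)
      with X(2) show False by blast
    qed
    define n where "n = N div 2"
    have n: "N = 2 * n + 1" "N = 2 * Suc n - 1" "Suc N = 2 * Suc n"
      using \<open>odd N\<close> by (auto simp: n_def)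
    obtain y s where "s = 1 \<or> s = - 1" "swap.chain_start (of_nat N) y"
      "swap.chain y n \<noteq> 0" "swap.step n (swap.chain y n) =
        scl M (of_int (s * int (Suc n))) (swap.chain y n)"
      using swap.folded_chain[of "Suc n" x] N n by (metis zero_less_Suc diff_Suc_1)
    then show ?thesis
      using isomorphic_B_mod[OF simple, of _ n] unfolding n(1) Suc_eq_plus1 by blast
  qed
qed

end
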